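(* Let $r\ge 1$ be an integer. Assume [K1], [H1], [H2], [G1] (listed in the context), that the operator $\mathcal G: C^0\to C^0$, $\mathcal G f=\mathcal K f+g$, is completely continuous, and that $f^*\in C^0$ is a fixed point of $\mathcal G$ such that $I-\mathcal G'(f^* )$ is invertible and $1$ is not an eigenvalue of $\mathcal G'(f^* )$. If $$\sup_{x\in[-1,1]}\|k_i(x,\cdot)\|_{W^r}<\infty,\qquad i=1,2,$$ then $\mathcal K f\in W^r$ for every $f\in C^0$. Consequently, if also $g\in W^r$, then the solution $f^*$ of $f=\mathcal G f$ belongs to $W^r$.
   Context: $C^0=C^0([-1,1])$ is the Banach space of real continuous functions on $[-1,1]$ with the norm $\|f\|_\infty=\max_{x\in[-1,1]}|f(x)|$. For an integer $r\ge1$ and $\varphi(x)=\sqrt{1-x^2}$, $$W^r=\{f\in C^0: f^{(r-1)}\in AC((-1,1)),\ \|f^{(r)}\varphi^r\|_\infty<\infty\},\qquad \|f\|_{W^r}=\|f\|_\infty+\|f^{(r)}\varphi^r\|_\infty,$$ where $AC((-1,1))$ is the set of absolutely continuous functions on $(-1,1)$. Given kernels $k_1,k_2$ on $[-1,1]^2$, a function $h:[-1,1]\times\mathbb R\to\mathbb R$ and $g$ on $[-1,1]$, define for $y,x\in[-1,1]$ $$(K^if)(y)=\int_{-1}^1k_i(x,y)f(x)\,dx\ (i=1,2),\qquad (Hf)(x)=h(x,f(x)),$$ $\mathcal K=K^1+K^2H$ and $\mathcal G f=\mathcal K f+g$. The equation $f=\mathcal G f$ is the integral equation $f(y)-\int_{-1}^1k_1(x,y)f(x)\,dx-\int_{-1}^1k_2(x,y)h(x,f(x))\,dx=g(y)$.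 Hypotheses: [K1] for $i=1,2$: $\sup_{y\in[-1,1]}\int_{-1}^1|k_i(x,y)|\,dx<\infty$ and $\lim_{y\to\tilde y}\int_{-1}^1|k_i(x,y)-k_i(x,\tilde y)|\,dx=0$ for every $\tilde y\in[-1,1]$. [H1] $h:[-1,1]\times\mathbb R\to\mathbb R$ is continuous. [H2] the partial derivative $h_v(x,v)=\partial h(x,v)/\partial v$ exists and is continuous for $x\in[-1,1]$, $v\in\mathbb R$. [G1] $g$ is continuous on $[-1,1]$. The Fréchet derivative of $\mathcal G$ at $f\in C^0$ is the linear operator on $C^0$ given by $$[(\mathcal G'f)\phi](y)=\int_{-1}^1k_1(x,y)\phi(x)\,dx+\int_{-1}^1k_2(x,y)h_v(x,f(x))\phi(x)\,dx .$$ *)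

theory Defs
  imports "HOL-Analysis.Analysis" "HOL-Probability.Essential_Supremum"
begin

section \<open>The Banach space of continuous functions on the interval from -1 to 1\<close>

typedef icc = "{-1..1 :: real}" morphisms of_icc to_icc
  by (rule exI[of _ 0]) simp

instantiation icc :: metric_space
begin

definition dist_icc :: "icc \<Rightarrow> icc \<Rightarrow> real"
  where "dist_icc x y = dist (of_icc x) (of_icc y)"

definition uniformity_icc :: "(icc \<times> icc) filter"
  where "uniformity_icc = (INF e\<in>{0<..}. principal {(x, y). dist x y < e})"

definition open_icc :: "icc set \<Rightarrow> bool"
  where "open_icc U = (\<forall>x\<in>U. \<forall>\<^sub>F (x', y) in uniformity. x' = x \<longrightarrow> y \<in> U)"

instance
proof
  fix x y z :: icc
  show "dist x y = 0 \<longleftrightarrow> x = y"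
    by (simp add: dist_icc_def of_icc_inject)
  show "dist x y \<le> dist x z + dist y z"
    by (simp add: dist_icc_def dist_triangle2)
qed (simp_all add: uniformity_icc_def open_icc_def)

end

text \<open>The norm of this type is the supremum norm.\<close>

type_synonym C0 = "icc \<Rightarrow>\<^sub>C real"

lemma continuous_on_of_icc: "continuous_on S of_icc"
  unfolding continuous_on_iff by (auto simp: dist_icc_def)

lemma continuous_on_to_icc: "continuous_on {-1..1} to_icc"
  unfolding continuous_on_iff by (auto simp: dist_icc_def to_icc_inverse)

lemma compact_UNIV_icc: "compact (UNIV :: icc set)"
proof -
  have "UNIV = to_icc ` {-1..1}"
    by (metis of_icc of_icc_inverse UNIV_eq_I image_eqI)
  then show ?thesis
    using compact_continuous_image[OF continuous_on_to_icc] by simp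
qed

lemma continuous_imp_bcontfun:
  fixes u :: "icc \<Rightarrow> real"
  assumes "continuous_on UNIV u"
  shows "u \<in> bcontfun"
  using compact_imp_bounded[OF compact_continuous_image[OF assms compact_UNIV_icc]] assms
  by (simp add: bcontfun_def)


section \<open>The integral operators\<close>

definition kernel_cond :: "(icc \<Rightarrow> icc \<Rightarrow> real) \<Rightarrow> bool"
  where "kernel_cond k \<longleftrightarrow>
    (\<forall>y. integrable (lebesgue_on {-1..1}) (\<lambda>x. k (to_icc x) y)) \<and>
    bdd_above (range (\<lambda>y. LINT x|lebesgue_on {-1..1}. \<bar>k (to_icc x) y\<bar>)) \<and>
    (\<forall>y'. ((\<lambda>y. LINT x|lebesgue_on {-1..1}. \<bar>k (to_icc x) y - k (to_icc x) y'\<bar>) \<longlongrightarrow> 0) (at y'))"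

text \<open>
  The kernel is integrated in its first argument. That the result is a continuous function,
  so that the use of \<^const>\<open>Bcontfun\<close> is legitimate, is the content of \<open>apply_int_op\<close> below.
\<close>

definition int_op :: "(icc \<Rightarrow> icc \<Rightarrow> real) \<Rightarrow> (icc \<Rightarrow> real) \<Rightarrow> C0"
  where "int_op k u =
    Bcontfun (\<lambda>y. LINT x|lebesgue_on {-1..1}. k (to_icc x) y * u (to_icc x))"

definition superposition :: "(icc \<Rightarrow> real \<Rightarrow> real) \<Rightarrow> C0 \<Rightarrow> icc \<Rightarrow> real"
  where "superposition h f x = h x (f x)"

definition K_op ::
    "(icc \<Rightarrow> icc \<Rightarrow> real) \<Rightarrow> (icc \<Rightarrow> icc \<Rightarrow> real) \<Rightarrow> (icc \<Rightarrow> real \<Rightarrow> real) \<Rightarrow> C0 \<Rightarrow> C0"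
  where "K_op k\<^sub>1 k\<^sub>2 h f = int_op k\<^sub>1 f + int_op k\<^sub>2 (superposition h f)"

definition G_op ::
    "(icc \<Rightarrow> icc \<Rightarrow> real) \<Rightarrow> (icc \<Rightarrow> icc \<Rightarrow> real) \<Rightarrow> (icc \<Rightarrow> real \<Rightarrow> real) \<Rightarrow> C0 \<Rightarrow> C0 \<Rightarrow> C0"
  where "G_op k\<^sub>1 k\<^sub>2 h g f = K_op k\<^sub>1 k\<^sub>2 h f + g"

text \<open>The Frechet derivative of \<^term>\<open>G_op k\<^sub>1 k\<^sub>2 h g\<close> at \<^term>\<open>f\<close>; see \<open>G_op_has_derivative\<close> below.\<close>

definition G_deriv ::
    "(icc \<Rightarrow> icc \<Rightarrow> real) \<Rightarrow> (icc \<Rightarrow> icc \<Rightarrow> real) \<Rightarrow> (icc \<Rightarrow> real \<Rightarrow> real) \<Rightarrow> C0 \<Rightarrow> C0 \<Rightarrow> C0"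
  where "G_deriv k\<^sub>1 k\<^sub>2 h f \<phi> =
    int_op k\<^sub>1 \<phi> + int_op k\<^sub>2 (\<lambda>x. deriv (h x) (f x) * \<phi> x)"

lemma integrable_kernel_mult:
  assumes k: "kernel_cond k" and u: "continuous_on UNIV u"
  shows "integrable (lebesgue_on {-1..1}) (\<lambda>x. k (to_icc x) y * u (to_icc x))"
proof -
  obtain B where B: "\<And>x. \<bar>u x\<bar> \<le> B"
    using continuous_imp_bcontfun[OF u] by (auto simp: bcontfun_def bounded_iff)
  have "continuous_on {-1..1} (\<lambda>x. u (to_icc x))"
    using continuous_on_compose2[OF u continuous_on_to_icc] by simp
  then have um: "(\<lambda>x. u (to_icc x)) \<in> borel_measurable (lebesgue_on {-1..1})"
    by (intro continuous_imp_measurable_on_sets_lebesgue) auto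
  have ki: "integrable (lebesgue_on {-1..1}) (\<lambda>x. k (to_icc x) y)"
    using k by (simp add: kernel_cond_def)
  show ?thesis
  proof (rule Bochner_Integration.integrable_bound)
    show "integrable (lebesgue_on {-1..1}) (\<lambda>x. B * k (to_icc x) y)"
      using ki by simp
    show "(\<lambda>x. k (to_icc x) y * u (to_icc x)) \<in> borel_measurable (lebesgue_on {-1..1})"
      using borel_measurable_integrable[OF ki] um by (rule borel_measurable_times)
    show "AE x in lebesgue_on {-1..1}. norm (k (to_icc x) y * u (to_icc x)) \<le> norm (B * k (to_icc x) y)"
    proof (rule AE_I2)
      fix x
      have "\<bar>u (to_icc x)\<bar> \<le> \<bar>B\<bar>" using B[of "to_icc x"] by linarith
      then show "norm (k (to_icc x) y * u (to_icc x)) \<le> norm (B * k (to_icc x) y)"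
        by (simp add: abs_mult mult.commute[of "\<bar>k (to_icc x) y\<bar>"] mult_right_mono)
    qed
  qed
qed

lemma int_op_bcontfun:
  assumes k: "kernel_cond k" and u: "continuous_on UNIV u"
  shows "(\<lambda>y. LINT x|lebesgue_on {-1..1}. k (to_icc x) y * u (to_icc x)) \<in> bcontfun"
    (is "?F \<in> _")
proof (rule continuous_imp_bcontfun, unfold continuous_on_def, intro ballI)
  fix y'
  let ?M = "lebesgue_on {-1..1::real}"
  obtain B where B: "\<And>x. \<bar>u x\<bar> \<le> B"
    using continuous_imp_bcontfun[OF u] by (auto simp: bcontfun_def bounded_iff)
  have ki: "integrable ?M (\<lambda>x. k (to_icc x) y)" for y
    using k by (simp add: kernel_cond_def)
  have lim: "((\<lambda>y. LINT x|?M. \<bar>k (to_icc x) y - k (to_icc x) y'\<bar>) \<longlongrightarrow> 0) (at y')"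
    using k by (simp add: kernel_cond_def)
  have bd: "norm (?F y - ?F y') \<le> (LINT x|?M. \<bar>k (to_icc x) y - k (to_icc x) y'\<bar>) * B" for y
  proof -
    have "norm (?F y - ?F y') =
        norm (LINT x|?M. k (to_icc x) y * u (to_icc x) - k (to_icc x) y' * u (to_icc x))"
      by (simp add: Bochner_Integration.integral_diff integrable_kernel_mult[OF k u])
    also have "\<dots> \<le> (LINT x|?M. norm (k (to_icc x) y * u (to_icc x) - k (to_icc x) y' * u (to_icc x)))"
      by (rule integral_norm_bound)
    also have "\<dots> \<le> (LINT x|?M. \<bar>k (to_icc x) y - k (to_icc x) y'\<bar> * B)"
    proof (rule integral_mono)
      fix x
      show "norm (k (to_icc x) y * u (to_icc x) - k (to_icc x) y' * u (to_icc x))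
          \<le> \<bar>k (to_icc x) y - k (to_icc x) y'\<bar> * B"
        using B[of "to_icc x"]
        by (simp add: left_diff_distrib[symmetric] abs_mult mult_left_mono)
    qed (auto intro!: integrable_kernel_mult[OF k u] ki)
    finally show ?thesis by simp
  qed
  have "((\<lambda>y. ?F y - ?F y') \<longlongrightarrow> 0) (at y')"
  proof (rule Lim_null_comparison)
    show "\<forall>\<^sub>F y in at y'. norm (?F y - ?F y') \<le> (LINT x|?M. \<bar>k (to_icc x) y - k (to_icc x) y'\<bar>) * B"
      using bd by simp
    show "((\<lambda>y. (LINT x|?M. \<bar>k (to_icc x) y - k (to_icc x) y'\<bar>) * B) \<longlongrightarrow> 0) (at y')"
      using tendsto_mult_right[OF lim, of B] by simp
  qed
  then show "(?F \<longlongrightarrow> ?F y') (at y')"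
    by (simp add: LIM_zero_iff)
qed

lemma apply_int_op:
  assumes "kernel_cond k" and "continuous_on UNIV u"
  shows "int_op k u y = (LINT x|lebesgue_on {-1..1}. k (to_icc x) y * u (to_icc x))"
  unfolding int_op_def by (simp add: Bcontfun_inverse int_op_bcontfun[OF assms])


lemma int_op_add:
  assumes k: "kernel_cond k" and u: "continuous_on UNIV u" and v: "continuous_on UNIV v"
  shows "int_op k (\<lambda>x. u x + v x) = int_op k u + int_op k v"
  by (rule bcontfun_eqI)
     (simp add: apply_int_op k u v continuous_on_add distrib_left
       Bochner_Integration.integral_add integrable_kernel_mult)

lemma int_op_scale:
  assumes k: "kernel_cond k" and u: "continuous_on UNIV u"
  shows "int_op k (\<lambda>x. c * u x) = c *\<^sub>R int_op k u"
proof (rule bcontfun_eqI)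
  fix y
  have "int_op k (\<lambda>x. c * u x) y =
      (LINT x|lebesgue_on {-1..1}. c * (k (to_icc x) y * u (to_icc x)))"
    by (simp add: apply_int_op k u continuous_on_mult_left mult.left_commute)
  also have "\<dots> = c * int_op k u y"
    by (simp add: apply_int_op k u)
  finally show "int_op k (\<lambda>x. c * u x) y = (c *\<^sub>R int_op k u) y"
    by simp
qed

lemma int_op_bound:
  assumes k: "kernel_cond k"
  obtains A where "A > 0"
    "\<And>u C. continuous_on UNIV u \<Longrightarrow> (\<And>x. \<bar>u x\<bar> \<le> C) \<Longrightarrow> norm (int_op k u) \<le> A * C"
proof -
  let ?M = "lebesgue_on {-1..1::real}"
  obtain A where A: "\<And>y. (LINT x|?M. \<bar>k (to_icc x) y\<bar>) \<le> A"
    using k by (auto simp: kernel_cond_def bdd_above_def)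
  have ki: "integrable ?M (\<lambda>x. k (to_icc x) y)" for y
    using k by (simp add: kernel_cond_def)
  have "norm (int_op k u) \<le> (\<bar>A\<bar> + 1) * C"
    if u: "continuous_on UNIV u" and C: "\<And>x. \<bar>u x\<bar> \<le> C" for u C
  proof (rule norm_bound)
    fix y
    have C0: "0 \<le> C" using C[of undefined] by linarith
    have "norm (int_op k u y) \<le> (LINT x|?M. norm (k (to_icc x) y * u (to_icc x)))"
      unfolding apply_int_op[OF k u] by (rule integral_norm_bound)
    also have "\<dots> \<le> (LINT x|?M. \<bar>k (to_icc x) y\<bar> * C)"
      using integrable_norm[OF integrable_kernel_mult[OF k u, of y]] integrable_abs[OF ki, of y]
      by (intro integral_mono) (auto intro!: mult_left_mono C simp: abs_mult)
    also have "\<dots> = (LINT x|?M. \<bar>k (to_icc x) y\<bar>) * C"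
      by simp
    also have "\<dots> \<le> (\<bar>A\<bar> + 1) * C"
      using A[of y] C0 by (intro mult_right_mono) auto
    finally show "norm (int_op k u y) \<le> (\<bar>A\<bar> + 1) * C" .
  qed
  then show ?thesis
    by (intro that[of "\<bar>A\<bar> + 1"]) auto
qed

lemma continuous_on_superposition:
  fixes f :: C0
  assumes "continuous_on UNIV (\<lambda>(x, v). h x v)"
  shows "continuous_on UNIV (\<lambda>x. h x (f x))"
  using continuous_on_compose2[OF assms, of UNIV "\<lambda>x. (x, f x)"]
    continuous_on_Pair[OF continuous_on_id continuous_on_apply_bcontfun[of UNIV f]]
  by simp

lemma abs_apply_le_norm: "\<bar>f x\<bar> \<le> norm f" for f :: C0
  using norm_bounded[of f x] by simp

lemma G_op_has_derivative:
  assumes k: "kernel_cond k\<^sub>1" "kernel_cond k\<^sub>2"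
    and h: "continuous_on UNIV (\<lambda>(x, v). h x v)"
    and hd: "\<And>x v. h x differentiable (at v)"
    and hc: "continuous_on UNIV (\<lambda>(x, v). deriv (h x) v)"
  shows "(G_op k\<^sub>1 k\<^sub>2 h g has_derivative G_deriv k\<^sub>1 k\<^sub>2 h f) (at f)"
  unfolding has_derivative_at_alt
proof (intro conjI allI impI)
  obtain A1 where A1: "A1 > 0"
    "\<And>u C. continuous_on UNIV u \<Longrightarrow> (\<And>x. \<bar>u x\<bar> \<le> C) \<Longrightarrow> norm (int_op k\<^sub>1 u) \<le> A1 * C"
    using int_op_bound[OF k(1)] by blast
  obtain A2 where A2: "A2 > 0"
    "\<And>u C. continuous_on UNIV u \<Longrightarrow> (\<And>x. \<bar>u x\<bar> \<le> C) \<Longrightarrow> norm (int_op k\<^sub>2 u) \<le> A2 * C"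
    using int_op_bound[OF k(2)] by blast
  define w where "w = (\<lambda>x. deriv (h x) (f x))"
  have wc: "continuous_on UNIV w"
    unfolding w_def by (rule continuous_on_superposition[OF hc])
  obtain B where B: "\<And>x. \<bar>w x\<bar> \<le> B"
    using continuous_imp_bcontfun[OF wc] by (auto simp: bcontfun_def bounded_iff)
  have Gd: "G_deriv k\<^sub>1 k\<^sub>2 h f \<phi> = int_op k\<^sub>1 \<phi> + int_op k\<^sub>2 (\<lambda>x. w x * \<phi> x)" for \<phi>
    by (simp add: G_deriv_def w_def)
  have wm: "continuous_on UNIV (\<lambda>x. w x * \<phi> x)" for \<phi> :: C0
    by (intro continuous_on_mult wc continuous_on_apply_bcontfun)
  show "bounded_linear (G_deriv k\<^sub>1 k\<^sub>2 h f)"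
  proof (rule bounded_linear_intro[where K = "A1 + A2 * B"])
    fix \<phi> \<psi> :: C0 and c :: real
    show "G_deriv k\<^sub>1 k\<^sub>2 h f (\<phi> + \<psi>) = G_deriv k\<^sub>1 k\<^sub>2 h f \<phi> + G_deriv k\<^sub>1 k\<^sub>2 h f \<psi>"
    proof -
      have "int_op k\<^sub>1 (\<phi> + \<psi>) = int_op k\<^sub>1 \<phi> + int_op k\<^sub>1 \<psi>"
        using int_op_add[OF k(1), of \<phi> \<psi>] by (simp add: plus_bcontfun.rep_eq)
      moreover have "int_op k\<^sub>2 (\<lambda>x. w x * (\<phi> + \<psi>) x) =
          int_op k\<^sub>2 (\<lambda>x. w x * \<phi> x) + int_op k\<^sub>2 (\<lambda>x. w x * \<psi> x)"
        using int_op_add[OF k(2) wm[of \<phi>] wm[of \<psi>]] by (simp add: distrib_left)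
      ultimately show ?thesis by (simp add: Gd)
    qed
    show "G_deriv k\<^sub>1 k\<^sub>2 h f (c *\<^sub>R \<phi>) = c *\<^sub>R G_deriv k\<^sub>1 k\<^sub>2 h f \<phi>"
    proof -
      have "int_op k\<^sub>1 (c *\<^sub>R \<phi>) = c *\<^sub>R int_op k\<^sub>1 \<phi>"
        using int_op_scale[OF k(1), of \<phi> c] by (simp add: scaleR_bcontfun.rep_eq)
      moreover have "int_op k\<^sub>2 (\<lambda>x. w x * (c *\<^sub>R \<phi>) x) = c *\<^sub>R int_op k\<^sub>2 (\<lambda>x. w x * \<phi> x)"
        using int_op_scale[OF k(2) wm[of \<phi>], of c] by (simp add: mult.left_commute)
      ultimately show ?thesis by (simp add: Gd scaleR_add_right)
    qed
    have "norm (int_op k\<^sub>1 \<phi>) \<le> A1 * norm \<phi>"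
      by (rule A1) (auto simp: abs_apply_le_norm)
    moreover have "norm (int_op k\<^sub>2 (\<lambda>x. w x * \<phi> x)) \<le> A2 * (B * norm \<phi>)"
    proof (rule A2(2)[OF wm])
      fix x
      have "0 \<le> B" using B[of x] by linarith
      then show "\<bar>w x * \<phi> x\<bar> \<le> B * norm \<phi>"
        unfolding abs_mult using B[of x] abs_apply_le_norm[of \<phi> x] by (intro mult_mono) auto
    qed
    ultimately show "norm (G_deriv k\<^sub>1 k\<^sub>2 h f \<phi>) \<le> norm \<phi> * (A1 + A2 * B)"
      unfolding Gd using norm_triangle_ineq[of "int_op k\<^sub>1 \<phi>" "int_op k\<^sub>2 (\<lambda>x. w x * \<phi> x)"]
      by (simp add: algebra_simps)
  qed
  fix e :: real
  assume e: "0 < e"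
  define N where "N = norm f + 1"
  have "uniformly_continuous_on (UNIV \<times> {-N..N}) (\<lambda>(x, v). deriv (h x) v)"
    by (intro compact_uniformly_continuous compact_Times compact_UNIV_icc compact_Icc
        continuous_on_subset[OF hc]) simp
  then obtain d where d: "d > 0" and du:
    "\<And>p q. p \<in> UNIV \<times> {-N..N} \<Longrightarrow> q \<in> UNIV \<times> {-N..N} \<Longrightarrow> dist q p < d \<Longrightarrow>
       dist (deriv (h (fst q)) (snd q)) (deriv (h (fst p)) (snd p)) < e / A2"
    unfolding uniformly_continuous_on_def case_prod_beta using e A2(1)
    by (metis divide_pos_pos)
  show "\<exists>d>0. \<forall>y. norm (y - f) < d \<longrightarrow>
      norm (G_op k\<^sub>1 k\<^sub>2 h g y - G_op k\<^sub>1 k\<^sub>2 h g f - G_deriv k\<^sub>1 k\<^sub>2 h f (y - f)) \<le> e * norm (y - f)"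
  proof (intro exI[of _ "min d 1"] conjI allI impI)
    show "0 < min d 1" using d by simp
    fix y :: C0
    assume y: "norm (y - f) < min d 1"
    define R where "R = (\<lambda>x. h x (y x) - h x (f x) - w x * (y - f) x)"
    have hy: "continuous_on UNIV (\<lambda>x. h x (y x))" and hf: "continuous_on UNIV (\<lambda>x. h x (f x))"
      by (rule continuous_on_superposition[OF h])+
    have Rc: "continuous_on UNIV R"
      unfolding R_def by (intro continuous_on_diff hy hf wm)
    have Rb: "\<bar>R x\<bar> \<le> e / A2 * norm (y - f)" for x
    proof -
      have yf: "\<bar>y x - f x\<bar> \<le> norm (y - f)"
        using abs_apply_le_norm[of "y - f" x] by simp
      have fN: "\<bar>f x\<bar> \<le> norm f" by (rule abs_apply_le_norm)
      define \<eta> where "\<eta> v = h x v - w x * v" for v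
      have der: "(\<eta> has_field_derivative (deriv (h x) v - w x)) (at v within S)" for v S
      proof -
        have "h x field_differentiable (at v)"
          using hd by (simp add: field_differentiable_def real_differentiable_def)
        then have "(h x has_field_derivative deriv (h x) v) (at v)"
          by (simp add: field_differentiable_derivI)
        then have "(\<eta> has_field_derivative (deriv (h x) v - w x * 1)) (at v)"
          unfolding \<eta>_def by (intro DERIV_diff DERIV_cmult DERIV_ident)
        then show ?thesis
          by (simp add: has_field_derivative_at_within)
      qed
      have "norm (\<eta> (y x) - \<eta> (f x)) \<le> e / A2 * norm (y x - f x)"
      proof (rule field_differentiable_bound[of "closed_segment (f x) (y x)"])
        fix v assume v: "v \<in> closed_segment (f x) (y x)"
        show "(\<eta> has_field_derivative (deriv (h x) v - w x)) (at v within closed_segment (f x) (y x))"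
          by (rule der)
        have vf: "\<bar>v - f x\<bar> \<le> \<bar>y x - f x\<bar>"
          using v by (auto simp: closed_segment_eq_real_ivl split: if_splits)
        show "norm (deriv (h x) v - w x) \<le> e / A2"
        proof -
          have "\<bar>v - f x\<bar> < d" "v \<in> {-N..N}" "f x \<in> {-N..N}"
            using vf yf fN y by (auto simp: N_def)
          then show ?thesis
            using du[of "(x, f x)" "(x, v)"]
            by (simp add: w_def dist_Pair_Pair dist_real_def)
        qed
      qed auto
      also have "\<dots> \<le> e / A2 * norm (y - f)"
        using yf e A2(1) by (intro mult_left_mono) auto
      finally show ?thesis
        by (simp add: \<eta>_def R_def algebra_simps)
    qed
    have "G_op k\<^sub>1 k\<^sub>2 h g y - G_op k\<^sub>1 k\<^sub>2 h g f - G_deriv k\<^sub>1 k\<^sub>2 h f (y - f) = int_op k\<^sub>2 R"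
    proof -
      have "int_op k\<^sub>1 y = int_op k\<^sub>1 f + int_op k\<^sub>1 (y - f)"
        using int_op_add[OF k(1) continuous_on_apply_bcontfun[of UNIV f]
            continuous_on_apply_bcontfun[of UNIV "y - f"]] by simp
      moreover have "int_op k\<^sub>2 (superposition h y) =
          int_op k\<^sub>2 (\<lambda>x. (superposition h f x + w x * (y - f) x) + R x)"
        by (rule arg_cong[where f = "int_op k\<^sub>2"]) (auto simp: superposition_def R_def)
      moreover have "\<dots> =
          int_op k\<^sub>2 (\<lambda>x. superposition h f x + w x * (y - f) x) + int_op k\<^sub>2 R"
        by (intro int_op_add k Rc continuous_on_add wm) (simp add: superposition_def hf)
      moreover have "int_op k\<^sub>2 (\<lambda>x. superposition h f x + w x * (y - f) x) =
          int_op k\<^sub>2 (superposition h f) + int_op k\<^sub>2 (\<lambda>x. w x * (y - f) x)"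
        by (intro int_op_add k wm) (simp add: superposition_def hf)
      ultimately show ?thesis
        by (simp add: G_op_def K_op_def Gd algebra_simps)
    qed
    then show "norm (G_op k\<^sub>1 k\<^sub>2 h g y - G_op k\<^sub>1 k\<^sub>2 h g f - G_deriv k\<^sub>1 k\<^sub>2 h f (y - f))
        \<le> e * norm (y - f)"
      using A2(2)[OF Rc Rb] A2(1) by simp
  qed
qed


section \<open>Completely continuous operators\<close>

definition completely_continuous :: "('a::metric_space \<Rightarrow> 'b::metric_space) \<Rightarrow> bool"
  where "completely_continuous T \<longleftrightarrow>
    continuous_on UNIV T \<and> (\<forall>B. bounded B \<longrightarrow> compact (closure (T ` B)))"


section \<open>The weighted Sobolev spaces\<close>

definition abs_continuous_on :: "real set \<Rightarrow> (real \<Rightarrow> real) \<Rightarrow> bool"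
  where "abs_continuous_on S F \<longleftrightarrow>
    (\<forall>\<epsilon>>0. \<exists>\<delta>>0. \<forall>D :: (real \<times> real) set.
      finite D \<and> (\<forall>(a, b)\<in>D. a \<le> b \<and> {a..b} \<subseteq> S) \<and>
      disjoint_family_on (\<lambda>(a, b). {a<..<b}) D \<and> (\<Sum>(a, b)\<in>D. b - a) < \<delta>
      \<longrightarrow> (\<Sum>(a, b)\<in>D. \<bar>F b - F a\<bar>) < \<epsilon>)"

text \<open>
  As usual for these spaces, absolute continuity on an open interval means absolute continuity
  on each of its compact subintervals. (The derivatives of order \<open>r - 1\<close> of functions in the
  space may be unbounded near the end points when \<open>r \<ge> 2\<close>.)
\<close>

definition AC_open :: "real \<Rightarrow> real \<Rightarrow> (real \<Rightarrow> real) set"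
  where "AC_open a b = {F. \<forall>c d. a < c \<and> c < d \<and> d < b \<longrightarrow> abs_continuous_on {c..d} F}"

definition nth_deriv :: "nat \<Rightarrow> C0 \<Rightarrow> real \<Rightarrow> real"
  where "nth_deriv n f = (deriv ^^ n) (\<lambda>x. f (to_icc x))"

text \<open>
  The derivative of order \<open>r\<close> of a function in the space is only defined almost everywhere,
  hence the essential supremum.
\<close>

definition weighted_seminorm :: "nat \<Rightarrow> C0 \<Rightarrow> ereal"
  where "weighted_seminorm r f =
    esssup (lebesgue_on {-1<..<1}) (\<lambda>x. ereal \<bar>nth_deriv r f x * sqrt (1 - x\<^sup>2) ^ r\<bar>)"

text \<open>
  Since \<^const>\<open>deriv\<close> is total, the existence of the derivatives of order less than \<open>r\<close>
  is required explicitly.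
\<close>

definition W_space :: "nat \<Rightarrow> C0 set"
  where "W_space r = {f.
    (\<forall>j < r - 1. \<forall>x\<in>{-1<..<1}. nth_deriv j f differentiable (at x)) \<and>
    nth_deriv (r - 1) f \<in> AC_open (-1) 1 \<and>
    weighted_seminorm r f < \<infinity>}"

definition W_norm :: "nat \<Rightarrow> C0 \<Rightarrow> ereal"
  where "W_norm r f = ereal (norm f) + weighted_seminorm r f"

definition kernel_sections_bounded :: "nat \<Rightarrow> (icc \<Rightarrow> icc \<Rightarrow> real) \<Rightarrow> bool"
  where "kernel_sections_bounded r k \<longleftrightarrow>
    (\<forall>x. k x \<in> bcontfun \<and> Bcontfun (k x) \<in> W_space r) \<and>
    (SUP x. W_norm r (Bcontfun (k x))) < \<infinity>"

end

theory Submission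
  imports Defs
begin

text \<open>
  Let \<open>\<phi> x = sqrt (1 - x\<^sup>2)\<close>. The idea is that a bound \<open>\<bar>f\<^sup>(\<^sup>r\<^sup>)\<bar> \<phi>\<^sup>r \<le> C\<close> almost everywhere
  for a function \<open>f\<close> whose derivative of order \<open>r - 1\<close> is locally absolutely continuous says the
  same as the pointwise Lipschitz bound
  \<open>\<bar>f\<^sup>(\<^sup>r\<^sup>-\<^sup>1\<^sup>) b - f\<^sup>(\<^sup>r\<^sup>-\<^sup>1\<^sup>) a\<bar> \<le> C * max (1 / \<phi> a ^ r) (1 / \<phi> b ^ r) * (b - a)\<close>
  for \<open>-1 < a \<le> b < 1\<close> (see \<open>W_spaceI\<close> and \<open>W_spaceD\<close>). The pointwise form is stable under integration
  against a parameter. This avoids every question about the joint measurability of the derivative of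
  order \<open>r\<close> of the kernel, which exists only for almost all \<open>y\<close>, with an exceptional set that depends
  on \<open>x\<close>.

  Passing to the pointwise form and back requires that an absolutely continuous function is
  differentiable almost everywhere (\<open>abs_continuous_on_imp_differentiable_ae\<close>) and that it is Lipschitz
  when its derivative is bounded almost everywhere (\<open>abs_continuous_on_increment_le\<close>). Both follow from
  Vitali's covering theorem: up to a set of small total length, on which absolute continuity
  makes \<open>F\<close> change little, an interval is filled by finitely many intervals on which the slope of \<open>F\<close>
  is under control.

  For the kernels, the sections \<open>k x\<close> are uniformly bounded and their derivatives of order \<open>r - 1\<close> are
  uniformly Lipschitz on each compact part of the open interval. By the mean value theorem all
  derivatives of lower order are then uniformly Lipschitz there as well
  (\<open>uniform_Lipschitz_derivatives\<close>), so dominated convergence allows one to differentiate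
  \<open>\<integral> k x y u x dx\<close> under the integral sign \<open>r - 1\<close> times, and the Lipschitz bound for the last derivative
  is inherited with \<open>C\<close> multiplied by the integral of \<open>\<bar>u\<bar>\<close> (\<open>smooth_integral_param\<close>). This gives the claim
  for both integral operators, since the superposition of \<open>h\<close> with a continuous function is again
  continuous. A fixed point is the sum of its image under the integral operators and \<open>g\<close>.
\<close>

section \<open>Finite systems of non-overlapping intervals\<close>

definition interval_system :: "real set \<Rightarrow> (real \<times> real) set \<Rightarrow> bool"
  where "interval_system S D \<longleftrightarrow> finite D \<and> (\<forall>(a, b)\<in>D. a < b \<and> {a..b} \<subseteq> S) \<and>
    disjoint_family_on (\<lambda>(a, b). {a<..<b}) D"

definition increment :: "(real \<Rightarrow> real) \<Rightarrow> (real \<times> real) set \<Rightarrow> real"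
  where "increment F D = (\<Sum>(a, b)\<in>D. F b - F a)"

abbreviation total_length :: "(real \<times> real) set \<Rightarrow> real"
  where "total_length \<equiv> increment (\<lambda>x. x)"

lemma interval_system_mono: "interval_system S D \<Longrightarrow> S \<subseteq> T \<Longrightarrow> interval_system T D"
  unfolding interval_system_def by blast

lemma interval_system_finite: "interval_system S D \<Longrightarrow> finite D"
  by (simp add: interval_system_def)

lemma interval_systemD:
  assumes "interval_system S D" "(a, b) \<in> D"
  shows "a < b" "{a..b} \<subseteq> S"
  using assms unfolding interval_system_def by blast+

lemma increment_mono:
  assumes "\<And>a b. (a, b) \<in> D \<Longrightarrow> F b - F a \<le> H b - H a"
  shows "increment F D \<le> increment H D"
  unfolding increment_def using assms by (intro sum_mono) auto

lemma abs_increment_le: "\<bar>increment F D\<bar> \<le> (\<Sum>(a, b)\<in>D. \<bar>F b - F a\<bar>)"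
  unfolding increment_def case_prod_beta by (rule sum_abs)

lemma increment_cmult: "increment (\<lambda>x. c * F x) D = c * increment F D"
  unfolding increment_def by (simp add: sum_distrib_left case_prod_beta right_diff_distrib)

lemma sum_measure_Int_interval_system:
  assumes D: "interval_system S D" and T: "T \<in> sets lebesgue"
  shows "(\<Sum>(a, b)\<in>D. measure lebesgue ({a<..<b} \<inter> T)) =
    measure lebesgue ((\<Union>(a, b)\<in>D. {a<..<b}) \<inter> T)"
proof -
  have "measure lebesgue (\<Union>i\<in>D. (case i of (a, b) \<Rightarrow> {a<..<b} \<inter> T)) =
      (\<Sum>i\<in>D. measure lebesgue (case i of (a, b) \<Rightarrow> {a<..<b} \<inter> T))"
  proof (rule measure_finite_Union)
    show "(\<lambda>i. case i of (a, b) \<Rightarrow> {a<..<b} \<inter> T) ` D \<subseteq> sets lebesgue"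
      using T by auto
    show "disjoint_family_on (\<lambda>i. case i of (a, b) \<Rightarrow> {a<..<b} \<inter> T) D"
      using D unfolding interval_system_def disjoint_family_on_def by fastforce
    fix i assume "i \<in> D"
    have "{fst i<..<snd i} \<inter> T \<in> lmeasurable"
      by (intro fmeasurable_Int_fmeasurable T) auto
    then show "emeasure lebesgue (case i of (a, b) \<Rightarrow> {a<..<b} \<inter> T) \<noteq> \<infinity>"
      using fmeasurableD2[of "{fst i<..<snd i} \<inter> T" lebesgue]
      by (simp add: case_prod_beta del: emeasure_completion)
  qed (use D in \<open>simp add: interval_system_def\<close>)
  moreover have "(\<Union>i\<in>D. (case i of (a, b) \<Rightarrow> {a<..<b} \<inter> T)) = (\<Union>(a, b)\<in>D. {a<..<b}) \<inter> T"
    by auto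
  ultimately show ?thesis by (simp add: case_prod_beta)
qed

lemma sum_measure_interval_system_le:
  assumes D: "interval_system S D" and T: "T \<in> sets lebesgue" and S: "S \<inter> T \<subseteq> U" "U \<in> lmeasurable"
  shows "(\<Sum>(a, b)\<in>D. measure lebesgue ({a<..<b} \<inter> T)) \<le> measure lebesgue U"
  unfolding sum_measure_Int_interval_system[OF D T]
proof (rule measure_mono_fmeasurable)
  have "{a<..<b} \<subseteq> S" if "(a, b) \<in> D" for a b
    using D that unfolding interval_system_def by fastforce
  then show "(\<Union>(a, b)\<in>D. {a<..<b}) \<inter> T \<subseteq> U"
    using S(1) by fastforce
  have "(\<Union>(a, b)\<in>D. {a<..<b}) \<in> sets lebesgue"
    by (intro sets.finite_UN interval_system_finite[OF D]) auto
  then show "(\<Union>(a, b)\<in>D. {a<..<b}) \<inter> T \<in> sets lebesgue"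
    using T by blast
qed (rule S(2))

lemma total_length_le:
  assumes D: "interval_system S D" and S: "S \<subseteq> U" "U \<in> lmeasurable"
  shows "total_length D \<le> measure lebesgue U"
proof -
  have "total_length D = (\<Sum>(a, b)\<in>D. measure lebesgue ({a<..<b} \<inter> UNIV))"
    unfolding increment_def using D by (intro sum.cong) (auto simp: interval_system_def)
  then show ?thesis
    using sum_measure_interval_system_le[OF D _ _ S(2), of UNIV] S(1) by simp
qed

lemma interval_system_insert:
  assumes D: "interval_system S D" and ab: "a < b" "{a..b} \<subseteq> S"
    and right: "\<And>u v. (u, v) \<in> D \<Longrightarrow> b \<le> u"
  shows "interval_system S (insert (a, b) D)"
proof -
  have "{a<..<b} \<inter> {fst i<..<snd i} = {}" "{fst i<..<snd i} \<inter> {a<..<b} = {}" if "i \<in> D" for i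
    using right[of "fst i" "snd i"] that by auto
  then have "disjoint_family_on (\<lambda>(a, b). {a<..<b}) (insert (a, b) D)"
    using D unfolding interval_system_def disjoint_family_on_def case_prod_beta
    by (auto simp del: greaterThanLessThan_iff Int_greaterThanLessThan greaterThanLessThan_empty_iff)
  then show ?thesis
    using D ab by (simp add: interval_system_def)
qed

text \<open>
  The gaps between the members of a system are again a system. Stating the second property for all \<open>F\<close>
  at once covers the total length of the gaps too, as the case of the identity.
\<close>

lemma interval_system_complement:
  assumes "interval_system {\<alpha>..\<beta>} D" "\<alpha> \<le> \<beta>"
  shows "\<exists>D'. interval_system {\<alpha>..\<beta>} D' \<and> (\<forall>F. increment F D' = F \<beta> - F \<alpha> - increment F D)"
proof -
  have "finite D" using assms by (simp add: interval_system_def)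
  then show ?thesis using assms
  proof (induction "card D" arbitrary: D \<alpha>)
    case 0
    then have "D = {}" by simp
    moreover have "interval_system {\<alpha>..\<beta>} (if \<alpha> < \<beta> then {(\<alpha>, \<beta>)} else {})"
      by (simp add: interval_system_def disjoint_family_on_def)
    ultimately show ?case
      using 0 by (intro exI[of _ "if \<alpha> < \<beta> then {(\<alpha>, \<beta>)} else {}"]) (auto simp: increment_def)
  next
    case (Suc n)
    then have "D \<noteq> {}" by auto
    \<comment> \<open>Split off the leftmost member \<open>(a, b)\<close>; the others lie in \<open>{b..\<beta>}\<close>.\<close>
    define a where "a = Min (fst ` D)"
    have "a \<in> fst ` D"
      unfolding a_def using Suc \<open>D \<noteq> {}\<close> by (intro Min_in) auto
    then obtain b where ab: "(a, b) \<in> D" by auto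
    have amin: "a \<le> a'" if "(a', b') \<in> D" for a' b'
      unfolding a_def using Suc that by (intro Min_le) (auto intro: rev_image_eqI)
    have ab': "a < b" "\<alpha> \<le> a" "b \<le> \<beta>"
      using ab Suc.prems by (auto simp: interval_system_def)
    define D0 where "D0 = D - {(a, b)}"
    have right: "b \<le> a'" if "(a', b') \<in> D0" for a' b'
    proof (rule ccontr)
      assume "\<not> b \<le> a'"
      have "a' < b'" "a \<le> a'" "(a', b') \<noteq> (a, b)" "(a', b') \<in> D"
        using that Suc.prems amin by (auto simp: D0_def interval_system_def)
      then have "{a<..<b} \<inter> {a'<..<b'} = {}"
        using Suc.prems ab unfolding interval_system_def disjoint_family_on_def by fastforce
      moreover have "a' < min b b'" using \<open>\<not> b \<le> a'\<close> \<open>a' < b'\<close> by simp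
      then have "(a' + min b b') / 2 \<in> {a<..<b} \<inter> {a'<..<b'}"
        using \<open>a \<le> a'\<close> by (auto simp: field_simps)
      ultimately show False by blast
    qed
    have "interval_system {b..\<beta>} D0"
      unfolding interval_system_def
    proof (intro conjI ballI)
      show "finite D0" using Suc by (simp add: D0_def)
      show "disjoint_family_on (\<lambda>(a, b). {a<..<b}) D0"
        using Suc.prems unfolding interval_system_def D0_def disjoint_family_on_def by blast
      fix i assume i: "i \<in> D0"
      then have "fst i < snd i \<and> {fst i..snd i} \<subseteq> {\<alpha>..\<beta>}"
        using Suc.prems by (auto simp: interval_system_def D0_def)
      then show "case i of (a', b') \<Rightarrow> a' < b' \<and> {a'..b'} \<subseteq> {b..\<beta>}"
        using right[of "fst i" "snd i"] i by auto
    qed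
    moreover have n0: "n = card D0"
      using Suc.hyps(2) Suc.prems(1) ab by (simp add: D0_def)
    ultimately obtain D' where D': "interval_system {b..\<beta>} D'"
      "\<And>F. increment F D' = F \<beta> - F b - increment F D0"
      using Suc.hyps(1)[of D0 b] n0 Suc.prems ab'(3) by (auto simp: D0_def)
    have inc: "increment F D = (F b - F a) + increment F D0" for F
      unfolding increment_def D0_def using ab Suc.prems by (subst sum.remove[OF _ ab]) auto
    show ?case
    proof (cases "\<alpha> < a")
      case True
      have below: "b \<le> u" if "(u, v) \<in> D'" for u v
        using D'(1) that by (auto simp: interval_system_def)
      then have new: "(\<alpha>, a) \<notin> D'"
        using ab' True by force
      have "interval_system {\<alpha>..\<beta>} (insert (\<alpha>, a) D')"
      proof (rule interval_system_insert)
        show "interval_system {\<alpha>..\<beta>} D'"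
          by (rule interval_system_mono[OF D'(1)]) (use ab' in auto)
        show "a \<le> u" if "(u, v) \<in> D'" for u v
          using below[OF that] ab' by simp
      qed (use ab' True in auto)
      moreover have "increment F (insert (\<alpha>, a) D') = F \<beta> - F \<alpha> - increment F D" for F
        using D'(2)[of F] inc[of F] new interval_system_finite[OF D'(1)]
        by (simp add: increment_def)
      ultimately show ?thesis by blast
    next
      case False
      then have "a = \<alpha>" using ab' by simp
      moreover have "interval_system {\<alpha>..\<beta>} D'"
        by (rule interval_system_mono[OF D'(1)]) (use ab' in auto)
      ultimately show ?thesis using D'(2) inc by (intro exI[of _ D']) auto
    qed
  qed
qed

text \<open>
  Replacing each member of a system by a system inside it again gives a system; this is how the gaps
  left in the several members are collected.
\<close>

lemma interval_system_Union:
  assumes I: "interval_system S I" and D: "\<And>a b. (a, b) \<in> I \<Longrightarrow> interval_system {a..b} (D (a, b))"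
  shows "interval_system S (\<Union>i\<in>I. D i)" "increment F (\<Union>i\<in>I. D i) = (\<Sum>i\<in>I. increment F (D i))"
proof -
  have sub: "u < v" "fst i \<le> u" "v \<le> snd i" "{u..v} \<subseteq> S"
    if "(u, v) \<in> D i" "i \<in> I" for i u v
  proof -
    have "interval_system {fst i..snd i} (D i)" using D[of "fst i" "snd i"] that by simp
    note * = interval_systemD[OF this that(1)]
    show "u < v" "fst i \<le> u" "v \<le> snd i" using * by auto
    then show "{u..v} \<subseteq> S" using interval_systemD[OF I, of "fst i" "snd i"] that(2) by force
  qed
  have open_disjoint: "{fst i<..<snd i} \<inter> {fst j<..<snd j} = {}" if "i \<in> I" "j \<in> I" "i \<noteq> j" for i j
    using I that unfolding interval_system_def disjoint_family_on_def case_prod_beta by blast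
  have disj: "{fst k<..<snd k} \<inter> {fst l<..<snd l} = {}"
    if "i \<in> I" "j \<in> I" "i \<noteq> j" "k \<in> D i" "l \<in> D j" for i j k l
  proof -
    have "{fst k<..<snd k} \<subseteq> {fst i<..<snd i}" "{fst l<..<snd l} \<subseteq> {fst j<..<snd j}"
      using sub[of "fst k" "snd k" i] sub[of "fst l" "snd l" j] that by auto
    then show ?thesis using open_disjoint[OF that(1-3)] by blast
  qed
  have fin: "finite I" "\<And>i. i \<in> I \<Longrightarrow> finite (D i)"
    using interval_system_finite[OF I] interval_system_finite[OF D] by auto
  show "interval_system S (\<Union>i\<in>I. D i)"
    unfolding interval_system_def
  proof (intro conjI)
    show "\<forall>(a, b)\<in>\<Union> (D ` I). a < b \<and> {a..b} \<subseteq> S" using sub(1,4) by blast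
    show "disjoint_family_on (\<lambda>(a, b). {a<..<b}) (\<Union>i\<in>I. D i)"
      unfolding disjoint_family_on_def case_prod_beta
    proof (intro ballI impI)
      fix k l assume "k \<in> (\<Union>i\<in>I. D i)" "l \<in> (\<Union>i\<in>I. D i)" "k \<noteq> l"
      then obtain i j where ij: "i \<in> I" "j \<in> I" "k \<in> D i" "l \<in> D j" by blast
      show "{fst k<..<snd k} \<inter> {fst l<..<snd l} = {}"
      proof (cases "i = j")
        case True
        have "interval_system {fst i..snd i} (D i)" using D[of "fst i" "snd i"] ij by simp
        then show ?thesis
          using True ij \<open>k \<noteq> l\<close> unfolding interval_system_def disjoint_family_on_def case_prod_beta by blast
      qed (use disj ij in blast)
    qed
  qed (use fin in auto)
  have "D i \<inter> D j = {}" if "i \<in> I" "j \<in> I" "i \<noteq> j" for i j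
  proof (rule ccontr)
    assume "D i \<inter> D j \<noteq> {}"
    then obtain k where k: "k \<in> D i" "k \<in> D j" by blast
    then have "{fst k<..<snd k} = {}" using disj[OF that k] by simp
    moreover have "fst k < snd k" using sub(1)[of "fst k" "snd k" i] k that by simp
    ultimately show False by simp
  qed
  then show "increment F (\<Union>i\<in>I. D i) = (\<Sum>i\<in>I. increment F (D i))"
    unfolding increment_def using fin by (intro sum.UNION_disjoint) auto
qed

text \<open>
  Vitali's covering theorem yields countably many disjoint intervals that cover almost all of \<open>E\<close>;
  by continuity of the measure finitely many of them already cover all but \<open>\<epsilon>\<close> of it.
\<close>

lemma Vitali_interval_system:
  assumes E: "E \<in> lmeasurable" and U: "open U" "E \<subseteq> U" and \<epsilon>: "\<epsilon> > 0"
    and fine: "\<And>x \<delta>. x \<in> E \<Longrightarrow> \<delta> > 0 \<Longrightarrow> \<exists>a b. a < x \<and> x < b \<and> b - a < \<delta> \<and> P a b"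
  obtains D where "interval_system U D" "\<And>a b. (a, b) \<in> D \<Longrightarrow> P a b"
    "total_length D > measure lebesgue E - \<epsilon>"
proof -
  define K where "K = {(a, b). a < b \<and> {a..b} \<subseteq> U \<and> P a b}"
  define m where "m i = (case i of (a, b) \<Rightarrow> (a + b) / 2)" for i :: "real \<times> real"
  define \<rho> where "\<rho> i = (case i of (a, b) \<Rightarrow> (b - a) / 2)" for i :: "real \<times> real"
  have cb: "cball (m i) (\<rho> i) = {fst i..snd i}" for i
    by (auto simp: m_def \<rho>_def cball_eq_atLeastAtMost case_prod_beta field_simps)
  obtain C where C: "countable C" "C \<subseteq> K"
      "pairwise (\<lambda>i j. disjnt (cball (m i) (\<rho> i)) (cball (m j) (\<rho> j))) C"
      "negligible (E - (\<Union>i\<in>C. cball (m i) (\<rho> i)))"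
  proof (rule Vitali_covering_theorem_cballs[of K \<rho> E m])
    show "0 < \<rho> i" if "i \<in> K" for i using that by (auto simp: K_def \<rho>_def)
    fix x d :: real assume x: "x \<in> E" and d: "0 < d"
    then obtain e where e: "e > 0" "ball x e \<subseteq> U" using U open_contains_ball by blast
    obtain a b where ab: "a < x" "x < b" "b - a < min d e" "P a b"
      using fine[OF x, of "min d e"] d e by auto
    have "{a..b} \<subseteq> ball x e" using ab by (auto simp: dist_real_def)
    then have "(a, b) \<in> K" using ab e by (auto simp: K_def)
    moreover have "\<rho> (a, b) < d" using ab by (simp add: \<rho>_def)
    ultimately show "\<exists>i. i \<in> K \<and> x \<in> cball (m i) (\<rho> i) \<and> \<rho> i < d"
      using ab unfolding cb by (intro exI[of _ "(a, b)"]) auto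
  qed (use that in auto)
  define J where "J i = {fst i..snd i}" for i :: "real \<times> real"
  have neg: "negligible (E - (\<Union>i\<in>C. J i))" using C(4) by (simp add: cb J_def)
  have disj: "J i \<inter> J j = {}" if "i \<in> C" "j \<in> C" "i \<noteq> j" for i j
    using C(3) that by (auto simp: pairwise_def disjnt_def cb J_def)
  have EJ: "E \<inter> J i \<in> lmeasurable" for i
    unfolding J_def by (intro fmeasurable_Int_fmeasurable E) auto
  have system: "interval_system U D" "\<And>a b. (a, b) \<in> D \<Longrightarrow> P a b" if "D \<subseteq> C" "finite D" for D
  proof -
    show "P a b" if "(a, b) \<in> D" for a b using that \<open>D \<subseteq> C\<close> C(2) by (auto simp: K_def)
    have "{fst i<..<snd i} \<subseteq> J i" for i by (auto simp: J_def)
    then have "disjoint_family_on (\<lambda>(a, b). {a<..<b}) D"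
      using disj \<open>D \<subseteq> C\<close> unfolding disjoint_family_on_def case_prod_beta by blast
    then show "interval_system U D"
      using that C(2) by (fastforce simp: interval_system_def K_def)
  qed
  have "\<exists>D. D \<subseteq> C \<and> finite D \<and> measure lebesgue E - \<epsilon> < (\<Sum>i\<in>D. measure lebesgue (E \<inter> J i))"
  proof (rule ccontr)
    assume "\<not> ?thesis"
    then have le: "(\<Sum>i\<in>D. measure lebesgue (E \<inter> J i)) \<le> measure lebesgue E - \<epsilon>"
      if "D \<subseteq> C" "finite D" for D using that by force
    have "measure lebesgue (\<Union>i\<in>C. E \<inter> J i) \<le> measure lebesgue E - \<epsilon>"
    proof (rule measure_UN_bound[OF C(1)])
      fix I assume I: "I \<subseteq> C" "finite I"
      have "measure lebesgue (\<Union>i\<in>I. E \<inter> J i) \<le> (\<Sum>i\<in>I. measure lebesgue (E \<inter> J i))"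
        using I(2) EJ by (intro measure_UNION_le) auto
      then show "measure lebesgue (\<Union>i\<in>I. E \<inter> J i) \<le> measure lebesgue E - \<epsilon>"
        using le[OF I] by linarith
    qed (use EJ in auto)
    moreover have "measure lebesgue (\<Union>i\<in>C. E \<inter> J i) = measure lebesgue E"
    proof (rule measure_negligible_symdiff)
      show "E \<in> lmeasurable" by (rule E)
      have "(E - (\<Union>i\<in>C. E \<inter> J i)) \<union> ((\<Union>i\<in>C. E \<inter> J i) - E) = E - (\<Union>i\<in>C. J i)" by auto
      then show "negligible ((E - (\<Union>i\<in>C. E \<inter> J i)) \<union> ((\<Union>i\<in>C. E \<inter> J i) - E))"
        using neg by simp
    qed
    ultimately show False using \<epsilon> by linarith
  qed
  then obtain D where D: "D \<subseteq> C" "finite D"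
    "measure lebesgue E - \<epsilon> < (\<Sum>i\<in>D. measure lebesgue (E \<inter> J i))" by blast
  have "(\<Sum>i\<in>D. measure lebesgue (E \<inter> J i)) \<le> total_length D"
    unfolding increment_def case_prod_beta
  proof (rule sum_mono)
    fix i assume i: "i \<in> D"
    have "measure lebesgue (E \<inter> J i) \<le> measure lebesgue (J i)"
      using EJ by (intro measure_mono_fmeasurable) (auto simp: J_def)
    also have "\<dots> = snd i - fst i" using i D(1) C(2) by (auto simp: J_def K_def)
    finally show "measure lebesgue (E \<inter> J i) \<le> snd i - fst i" .
  qed
  then show thesis
    using that system[OF D(1,2)] D(3) by auto
qed

section \<open>Differentiability of absolutely continuous functions\<close>

lemma abs_continuous_on_increment:
  assumes F: "abs_continuous_on S F" and \<epsilon>: "\<epsilon> > 0"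
  obtains \<delta> where "\<delta> > 0"
    "\<And>D. interval_system S D \<Longrightarrow> total_length D < \<delta> \<Longrightarrow> \<bar>increment F D\<bar> < \<epsilon>"
proof -
  obtain \<delta> where \<delta>: "\<delta> > 0" "\<And>D. finite D \<and> (\<forall>(a, b)\<in>D. a \<le> b \<and> {a..b} \<subseteq> S) \<and>
      disjoint_family_on (\<lambda>(a, b). {a<..<b}) D \<and> (\<Sum>(a, b)\<in>D. b - a) < \<delta>
      \<Longrightarrow> (\<Sum>(a, b)\<in>D. \<bar>F b - F a\<bar>) < \<epsilon>"
    using F \<epsilon> unfolding abs_continuous_on_def by meson
  show thesis
  proof (rule that[OF \<delta>(1)])
    fix D assume D: "interval_system S D" "total_length D < \<delta>"
    have "(\<Sum>(a, b)\<in>D. \<bar>F b - F a\<bar>) < \<epsilon>"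
    proof (rule \<delta>(2), intro conjI)
      show "\<forall>(a, b)\<in>D. a \<le> b \<and> {a..b} \<subseteq> S"
        using interval_systemD[OF D(1)] by (blast intro: less_imp_le)
    qed (use D in \<open>simp_all add: interval_system_def increment_def\<close>)
    then show "\<bar>increment F D\<bar> < \<epsilon>" using abs_increment_le[of F D] by linarith
  qed
qed

lemma abs_continuous_on_minus: "abs_continuous_on S F \<Longrightarrow> abs_continuous_on S (\<lambda>x. - F x)"
  unfolding abs_continuous_on_def by (simp add: abs_minus_commute)

lemma abs_continuous_on_imp_continuous_on:
  assumes F: "abs_continuous_on {c..d} F"
  shows "continuous_on {c..d} F"
  unfolding continuous_on_iff
proof (intro ballI allI impI)
  fix x \<epsilon> :: real assume x: "x \<in> {c..d}" and "0 < \<epsilon>"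
  then obtain \<delta> where \<delta>: "\<delta> > 0"
    "\<And>D. interval_system {c..d} D \<Longrightarrow> total_length D < \<delta> \<Longrightarrow> \<bar>increment F D\<bar> < \<epsilon>"
    using abs_continuous_on_increment[OF F] by blast
  have "\<bar>F b - F a\<bar> < \<epsilon>" "\<bar>F a - F b\<bar> < \<epsilon>" if "a < b" "{a..b} \<subseteq> {c..d}" "b - a < \<delta>" for a b
    using \<delta>(2)[of "{(a, b)}"] that
    by (simp_all add: interval_system_def increment_def disjoint_family_on_def abs_minus_commute)
  then have "dist (F y) (F x) < \<epsilon>" if "y \<in> {c..d}" "dist y x < \<delta>" for y
    using that x \<open>0 < \<epsilon>\<close> by (cases y x rule: linorder_cases) (auto simp: dist_real_def)
  then show "\<exists>d'>0. \<forall>x'\<in>{c..d}. dist x' x < d' \<longrightarrow> dist (F x') (F x) < \<epsilon>"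
    using \<delta>(1) by blast
qed

text \<open>
  For continuous \<open>F\<close> this set contains the points whose upper derivative exceeds \<open>q\<close>. Asking for intervals
  with the point in their interior makes it a countable intersection of open sets, which settles its
  measurability. The corresponding set for slopes below \<open>p\<close> is \<open>steep_points (\<lambda>x. - F x) c d (- p)\<close>.
\<close>

definition steep_points :: "(real \<Rightarrow> real) \<Rightarrow> real \<Rightarrow> real \<Rightarrow> real \<Rightarrow> real set"
  where "steep_points F c d q =
    {x. \<forall>\<delta>>0. \<exists>a b. c < a \<and> a < x \<and> x < b \<and> b < d \<and> b - a < \<delta> \<and> F b - F a > q * (b - a)}"

lemma steep_points_measurable: "steep_points F c d q \<in> sets borel"
proof -
  define N where "N n = \<Union>{{a<..<b} | a b. c < a \<and> b < d \<and> b - a < inverse (real (Suc n)) \<and>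
    F b - F a > q * (b - a)}" for n
  have "steep_points F c d q = (\<Inter>n. N n)"
  proof
    show "steep_points F c d q \<subseteq> (\<Inter>n. N n)"
    proof (intro subsetI INT_I)
      fix x n assume "x \<in> steep_points F c d q"
      moreover have "inverse (real (Suc n)) > 0" by simp
      ultimately obtain a b where "c < a" "a < x" "x < b" "b < d" "b - a < inverse (real (Suc n))"
        "F b - F a > q * (b - a)"
        unfolding steep_points_def by blast
      then show "x \<in> N n" unfolding N_def by (intro UnionI[of "{a<..<b}"]) auto
    qed
    show "(\<Inter>n. N n) \<subseteq> steep_points F c d q"
      unfolding steep_points_def
    proof (intro subsetI CollectI allI impI)
      fix x \<delta> :: real assume x: "x \<in> (\<Inter>n. N n)" and "0 < \<delta>"
      obtain n where n: "inverse (real (Suc n)) < \<delta>" using reals_Archimedean[OF \<open>0 < \<delta>\<close>] by blast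
      have "x \<in> N n" using x by blast
      then obtain a b where "c < a" "a < x" "x < b" "b < d" "b - a < inverse (real (Suc n))"
        "F b - F a > q * (b - a)" unfolding N_def by auto
      then show "\<exists>a b. c < a \<and> a < x \<and> x < b \<and> b < d \<and> b - a < \<delta> \<and> F b - F a > q * (b - a)"
        using n by (intro exI[of _ a] exI[of _ b]) auto
    qed
  qed
  moreover have "open (N n)" for n unfolding N_def by (rule open_Union) auto
  ultimately show ?thesis by (simp add: borel_open)
qed

lemma steep_points_subset: "steep_points F c d q \<subseteq> {c<..<d}"
proof
  fix x assume "x \<in> steep_points F c d q"
  then obtain a b where "c < a" "a < x" "x < b" "b < d"
    unfolding steep_points_def by (auto dest: spec[of _ 1])
  then show "x \<in> {c<..<d}" by simp
qed

lemma steep_points_lmeasurable: "steep_points F c d q \<in> lmeasurable"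
proof -
  have "steep_points F c d q \<inter> {c<..<d} \<in> lmeasurable"
    using sets_completionI_sets[of _ lborel] steep_points_measurable[of F c d q]
    by (subst Int_commute) (intro fmeasurable_Int_fmeasurable; simp)
  then show ?thesis using steep_points_subset[of F c d q] by (simp add: Int_absorb2)
qed

text \<open>
  Intervals of slope greater than \<open>q\<close> fill \<open>{a<..<b}\<close> up to the system \<open>D\<close> of gaps, whose total
  length is governed by the part of the interval outside \<open>E\<close>.
\<close>

lemma increment_ge_on_steep_interval:
  assumes ab: "a < b" and E: "E \<in> lmeasurable" "\<epsilon> > 0"
    and steep: "E \<inter> {a<..<b} \<subseteq> steep_points F c d q"
  obtains D where "interval_system {a..b} D" "F b - F a \<ge> q * (b - a - total_length D) + increment F D"
    "total_length D \<le> measure lebesgue ({a<..<b} - E) + \<epsilon> * (b - a)"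
proof -
  have Em: "E \<inter> {a<..<b} \<in> lmeasurable" by (intro fmeasurable_Int_fmeasurable E) auto
  have \<epsilon>': "\<epsilon> * (b - a) > 0" using ab E by simp
  obtain J where J: "interval_system {a<..<b} J" "\<And>u v. (u, v) \<in> J \<Longrightarrow> q * (v - u) < F v - F u"
    "total_length J > measure lebesgue (E \<inter> {a<..<b}) - \<epsilon> * (b - a)"
  proof (rule Vitali_interval_system[OF Em, of "{a<..<b}" "\<epsilon> * (b - a)" "\<lambda>u v. q * (v - u) < F v - F u"])
    fix x \<delta> :: real assume "x \<in> E \<inter> {a<..<b}" "\<delta> > 0"
    then show "\<exists>u v. u < x \<and> x < v \<and> v - u < \<delta> \<and> q * (v - u) < F v - F u"
      using steep unfolding steep_points_def by blast
  qed (use \<epsilon>' that in auto)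
  have J': "interval_system {a..b} J" by (rule interval_system_mono[OF J(1)]) auto
  obtain D where D: "interval_system {a..b} D"
    "\<And>F. increment F D = F b - F a - increment F J"
    using interval_system_complement[OF J'] ab by auto
  have "increment (\<lambda>x. q * x) J \<le> increment F J"
    by (rule increment_mono) (use J(2) in \<open>force simp: algebra_simps\<close>)
  then have 1: "q * total_length J \<le> increment F J" by (simp add: increment_cmult)
  have "measure lebesgue {a<..<b} =
      measure lebesgue (E \<inter> {a<..<b}) + measure lebesgue ({a<..<b} - E)"
  proof -
    have "{a<..<b} = E \<inter> {a<..<b} \<union> ({a<..<b} - E)" by auto
    moreover have "measure lebesgue (E \<inter> {a<..<b} \<union> ({a<..<b} - E)) =
        measure lebesgue (E \<inter> {a<..<b}) + measure lebesgue ({a<..<b} - E)"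
    proof -
      have "E \<inter> {a<..<b} \<inter> ({a<..<b} - E) = {}" by auto
      then show ?thesis using Em E by (subst measure_Un3) (auto intro!: fmeasurable.Diff)
    qed
    ultimately show ?thesis by simp
  qed
  then have "total_length D \<le> measure lebesgue ({a<..<b} - E) + \<epsilon> * (b - a)"
    using D(2)[of "\<lambda>x. x"] J(3) ab by simp
  moreover have "F b - F a \<ge> q * (b - a - total_length D) + increment F D"
    using D(2)[of "\<lambda>x. x"] D(2)[of F] 1 by simp
  ultimately show thesis using that D(1) by blast
qed

text \<open>
  Cover the set \<open>E\<close> of these points by a system \<open>I\<close> of slope less than \<open>p\<close> inside an open set only
  slightly larger than \<open>E\<close>, and fill each member of \<open>I\<close> by intervals of slope greater than \<open>q\<close>. What is
  left over has small total length, so it contributes little to the increment of \<open>F\<close>. Hence the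
  increment over \<open>I\<close> is at most \<open>p\<close> times the length of \<open>I\<close> and, up to a small error, at least \<open>q\<close>
  times this length. So the length of \<open>I\<close> is small, and it is close to the measure of \<open>E\<close>.
\<close>

lemma two_slopes_null:
  assumes F: "abs_continuous_on {c..d} F" and pq: "p < q"
  shows "negligible (steep_points F c d q \<inter> steep_points (\<lambda>x. - F x) c d (- p))" (is "negligible ?E")
proof -
  have E: "?E \<in> lmeasurable"
    by (intro fmeasurable_Int_fmeasurable steep_points_lmeasurable fmeasurableD)
  define \<mu> where "\<mu> = measure lebesgue ?E"
  have bound: "(q - p) * (\<mu> - \<epsilon>) \<le> (\<bar>q\<bar> + 1) * \<eta>" if "\<epsilon> > 0" "\<eta> > 0" for \<epsilon> \<eta>
  proof (cases "c < d")
    case False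
    then have "?E = {}" using steep_points_subset[of F c d q] by auto
    then show ?thesis using that pq by (simp add: \<mu>_def mult_nonneg_nonpos) (smt (verit) mult_nonneg_nonneg mult_pos_pos)
  next
    case True
    obtain \<delta> where \<delta>: "\<delta> > 0"
      "\<And>D. interval_system {c..d} D \<Longrightarrow> total_length D < \<delta> \<Longrightarrow> \<bar>increment F D\<bar> < \<eta>"
      using abs_continuous_on_increment[OF F \<open>\<eta> > 0\<close>] by blast
    define \<kappa> where "\<kappa> = min \<delta> \<eta> / 2"
    have \<kappa>: "\<kappa> > 0" "2 * \<kappa> \<le> \<delta>" "2 * \<kappa> \<le> \<eta>" using \<delta>(1) that by (auto simp: \<kappa>_def)
    obtain V where V: "open V" "?E \<subseteq> V" "V - ?E \<in> lmeasurable" "emeasure lebesgue (V - ?E) < ennreal \<kappa>"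
      using sets_lebesgue_outer_open[OF fmeasurableD[OF E] \<kappa>(1)] by blast
    define U where "U = V \<inter> {c<..<d}"
    have U: "open U" "?E \<subseteq> U" "U - ?E \<in> lmeasurable" "measure lebesgue (U - ?E) < \<kappa>"
    proof -
      show "open U" unfolding U_def using V by auto
      show "?E \<subseteq> U" using V(2) steep_points_subset[of F c d q] by (auto simp: U_def)
      have "U - ?E = (V - ?E) \<inter> {c<..<d}" by (auto simp: U_def)
      then show l: "U - ?E \<in> lmeasurable" using V(3) by (simp add: fmeasurable_Int_fmeasurable)
      have "measure lebesgue (U - ?E) \<le> measure lebesgue (V - ?E)"
        using V(3) l by (intro measure_mono_fmeasurable) (auto simp: U_def)
      also have "\<dots> < \<kappa>"
        using V(3,4) \<kappa>(1) by (simp add: emeasure_eq_measure2 ennreal_less_iff del: emeasure_completion)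
      finally show "measure lebesgue (U - ?E) < \<kappa>" .
    qed
    obtain I where I: "interval_system U I" "\<And>a b. (a, b) \<in> I \<Longrightarrow> F b - F a < p * (b - a)"
      "total_length I > measure lebesgue ?E - \<epsilon>"
    proof (rule Vitali_interval_system[OF E U(1,2) \<open>\<epsilon> > 0\<close>, of "\<lambda>a b. F b - F a < p * (b - a)"])
      fix x \<delta> :: real assume "x \<in> ?E" "\<delta> > 0"
      then have "\<exists>a b. c < a \<and> a < x \<and> x < b \<and> b < d \<and> b - a < \<delta> \<and> - F b - (- F a) > - p * (b - a)"
        unfolding steep_points_def by blast
      then show "\<exists>a b. a < x \<and> x < b \<and> b - a < \<delta> \<and> F b - F a < p * (b - a)"
        by (elim ex_forward) auto
    qed (use that in auto)
    have I': "interval_system {c..d} I"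
      by (rule interval_system_mono[OF I(1)]) (auto simp: U_def)
    define \<epsilon>' where "\<epsilon>' = \<kappa> / (d - c)"
    have \<epsilon>': "\<epsilon>' > 0" using \<kappa> True by (simp add: \<epsilon>'_def)
    have "\<exists>D. interval_system {fst i..snd i} D \<and>
        F (snd i) - F (fst i) \<ge> q * (snd i - fst i - total_length D) + increment F D \<and>
        total_length D \<le> measure lebesgue ({fst i<..<snd i} - ?E) + \<epsilon>' * (snd i - fst i)"
      if "i \<in> I" for i
      using increment_ge_on_steep_interval[of "fst i" "snd i" ?E \<epsilon>' F c d q] E \<epsilon>' interval_systemD[OF I(1), of "fst i" "snd i"] that
      by auto
    then obtain D where D: "\<And>i. i \<in> I \<Longrightarrow> interval_system {fst i..snd i} (D i)"
        "\<And>i. i \<in> I \<Longrightarrow> F (snd i) - F (fst i) \<ge> q * (snd i - fst i - total_length (D i)) + increment F (D i)"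
        "\<And>i. i \<in> I \<Longrightarrow> total_length (D i) \<le> measure lebesgue ({fst i<..<snd i} - ?E) + \<epsilon>' * (snd i - fst i)"
      by metis
    define G where "G = (\<Union>i\<in>I. D i)"
    have G: "interval_system {c..d} G" "\<And>F. increment F G = (\<Sum>i\<in>I. increment F (D i))"
      unfolding G_def using interval_system_Union[OF I'] D(1) by (auto)
    \<comment> \<open>The gaps left in all members of \<open>I\<close> have total length less than \<open>2 * \<kappa>\<close>.\<close>
    have lenI: "total_length I \<le> d - c"
      using total_length_le[OF I', of "{c..d}"] True by simp
    have Ec: "- ?E \<in> sets lebesgue"
      using sets.compl_sets[OF fmeasurableD[OF E]] by (simp add: Compl_eq_Diff_UNIV del: Diff_Int)
    have "total_length G \<le> (\<Sum>i\<in>I. measure lebesgue ({fst i<..<snd i} - ?E) + \<epsilon>' * (snd i - fst i))"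
      unfolding G by (rule sum_mono) (rule D(3))
    also have "\<dots> = (\<Sum>(a, b)\<in>I. measure lebesgue ({a<..<b} \<inter> - ?E)) + \<epsilon>' * total_length I"
      by (simp add: sum.distrib sum_distrib_left case_prod_beta increment_def Diff_eq)
    also have "\<dots> \<le> measure lebesgue (U - ?E) + \<epsilon>' * (d - c)"
      using \<epsilon>' lenI U(3) Ec
      by (intro add_mono mult_left_mono sum_measure_interval_system_le[OF I(1)])
        (auto simp del: Compl_Int Diff_Int)
    also have "\<dots> < 2 * \<kappa>" using U(4) True by (simp add: \<epsilon>'_def)
    finally have lenG: "total_length G < 2 * \<kappa>" .
    have incG: "\<bar>increment F G\<bar> < \<eta>" using \<delta>(2)[OF G(1)] lenG \<kappa> by simp
    have lenG0: "0 \<le> total_length G"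
      unfolding increment_def using interval_systemD(1)[OF G(1)] by (intro sum_nonneg) force
    \<comment> \<open>Compare the increment of \<open>F\<close> over \<open>I\<close> computed with the two slopes.\<close>
    have "q * (total_length I - total_length G) + increment F G =
        (\<Sum>i\<in>I. q * (snd i - fst i - total_length (D i)) + increment F (D i))"
      unfolding G increment_def[of _ I] case_prod_beta
      by (simp add: sum.distrib sum_distrib_left sum_subtractf right_diff_distrib)
    also have "\<dots> \<le> (\<Sum>i\<in>I. F (snd i) - F (fst i))"
      by (rule sum_mono) (rule D(2))
    also have "\<dots> = increment F I" by (simp add: increment_def case_prod_beta)
    also have "\<dots> \<le> increment (\<lambda>x. p * x) I"
      by (rule increment_mono) (use I(2) in \<open>force simp: algebra_simps\<close>)
    also have "\<dots> = p * total_length I" by (rule increment_cmult)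
    finally have "(q - p) * total_length I \<le> q * total_length G - increment F G"
      by (simp add: algebra_simps)
    also have "\<dots> \<le> \<bar>q\<bar> * \<eta> + \<eta>"
    proof -
      have "q * total_length G \<le> \<bar>q\<bar> * \<eta>" using lenG lenG0 \<kappa> by (intro mult_mono) auto
      then show ?thesis using incG by linarith
    qed
    finally have "(q - p) * total_length I \<le> (\<bar>q\<bar> + 1) * \<eta>" by (simp add: algebra_simps)
    moreover have "(q - p) * (\<mu> - \<epsilon>) \<le> (q - p) * total_length I"
      using I(3) pq by (intro mult_left_mono) (auto simp: \<mu>_def)
    ultimately show ?thesis by linarith
  qed
  have "\<mu> \<le> 0"
  proof (rule ccontr)
    assume "\<not> \<mu> \<le> 0"
    then have "\<mu> > 0" by simp
    \<comment> \<open>With \<open>\<epsilon> = \<mu> / 2\<close> this makes the right-hand side of \<open>bound\<close> half of the left-hand side.\<close>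
    define \<eta> where "\<eta> = (q - p) * \<mu> / (4 * (\<bar>q\<bar> + 1))"
    have "\<eta> > 0" using pq \<open>\<mu> > 0\<close> by (simp add: \<eta>_def add_nonneg_pos)
    have "(\<bar>q\<bar> + 1) * \<eta> = (q - p) * \<mu> / 4" by (simp add: \<eta>_def field_simps add_nonneg_eq_0_iff)
    moreover have "(q - p) * (\<mu> - \<mu> / 2) = (q - p) * \<mu> / 2" by (simp add: field_simps)
    moreover have "(q - p) * \<mu> > 0" using pq \<open>\<mu> > 0\<close> by simp
    ultimately show False using bound[of "\<mu> / 2" \<eta>] \<open>\<mu> > 0\<close> \<open>\<eta> > 0\<close> by linarith
  qed
  then have "measure lebesgue ?E = 0" using measure_nonneg[of lebesgue ?E] by (simp add: \<mu>_def)
  then show ?thesis using E by (simp add: negligible_iff_measure)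
qed

text \<open>
  On an interval shorter than the \<open>\<delta>\<close> that absolute continuity assigns to \<open>1\<close>, a system of slope greater
  than \<open>q > 0\<close> has total length at most \<open>1 / q\<close>. As \<open>q\<close> is arbitrary, the set is null in every such
  interval, and being null is a local property.
\<close>

lemma infinite_slope_null:
  assumes F: "abs_continuous_on {c..d} F"
  shows "negligible (\<Inter>q. steep_points F c d q)" (is "negligible ?E")
proof -
  have E: "?E \<in> sets lebesgue"
  proof -
    have eq: "?E = (\<Inter>n. steep_points F c d (real n))"
    proof (intro equalityI subsetI INT_I)
      fix x q assume x: "x \<in> (\<Inter>n. steep_points F c d (real n))"
      obtain n where n: "q \<le> real n" using real_arch_simple by blast
      have "x \<in> steep_points F c d (real n)" using x by blast
      moreover have "q * (b - a) < F b - F a" if "real n * (b - a) < F b - F a" "a < x" "x < b" for a b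
        using mult_right_mono[OF n, of "b - a"] that by linarith
      ultimately show "x \<in> steep_points F c d q"
        unfolding steep_points_def mem_Collect_eq by meson
    qed auto
    show ?thesis unfolding eq using steep_points_measurable by (intro sets.countable_INT) auto
  qed
  obtain \<delta> where \<delta>: "\<delta> > 0"
    "\<And>D. interval_system {c..d} D \<Longrightarrow> total_length D < \<delta> \<Longrightarrow> \<bar>increment F D\<bar> < 1"
    using abs_continuous_on_increment[OF F, of 1] by auto
  have small: "negligible (?E \<inter> {s<..<s + \<delta> / 2})" for s
  proof -
    let ?U = "{s<..<s + \<delta> / 2} \<inter> {c<..<d}"
    define E1 where "E1 = ?E \<inter> {s<..<s + \<delta> / 2}"
    have E1: "E1 \<in> lmeasurable" unfolding E1_def using E
      by (subst Int_commute) (intro fmeasurable_Int_fmeasurable; simp)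
    have E1U: "E1 \<subseteq> ?U" using steep_points_subset[of F c d 0] unfolding E1_def by blast
    have bound: "q * (measure lebesgue E1 - \<epsilon>) \<le> 1" if "q > 0" "\<epsilon> > 0" for q \<epsilon>
    proof -
      obtain D where D: "interval_system ?U D" "\<And>a b. (a, b) \<in> D \<Longrightarrow> F b - F a > q * (b - a)"
        "total_length D > measure lebesgue E1 - \<epsilon>"
      proof (rule Vitali_interval_system[OF E1 _ E1U \<open>\<epsilon> > 0\<close>, of "\<lambda>a b. F b - F a > q * (b - a)"])
        fix x \<delta> :: real assume "x \<in> E1" "\<delta> > 0"
        then have "x \<in> steep_points F c d q" by (auto simp: E1_def)
        then show "\<exists>a b. a < x \<and> x < b \<and> b - a < \<delta> \<and> F b - F a > q * (b - a)"
          using \<open>\<delta> > 0\<close> unfolding steep_points_def by blast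
      qed (use that in auto)
      have "total_length D \<le> measure lebesgue {s<..<s + \<delta> / 2}"
        by (rule total_length_le[OF D(1)]) auto
      then have "total_length D < \<delta>" using \<delta>(1) by simp
      moreover have "interval_system {c..d} D" by (rule interval_system_mono[OF D(1)]) auto
      ultimately have "increment F D < 1" using \<delta>(2)[of D] by simp
      moreover have "increment (\<lambda>x. q * x) D \<le> increment F D"
        by (rule increment_mono) (use D(2) in \<open>force simp: algebra_simps\<close>)
      moreover have "q * (measure lebesgue E1 - \<epsilon>) \<le> q * total_length D"
        using D(3) that by (intro mult_left_mono) auto
      ultimately show ?thesis by (simp add: increment_cmult)
    qed
    have "measure lebesgue E1 = 0"
    proof (rule ccontr)
      let ?m = "measure lebesgue E1"
      assume "?m \<noteq> 0"
      then have "?m > 0" using measure_nonneg[of lebesgue E1] by linarith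
      then show False using bound[of "4 / ?m" "?m / 2"] by (simp add: field_simps)
    qed
    then show ?thesis using E1 by (simp add: negligible_iff_measure E1_def)
  qed
  show ?thesis
    unfolding locally_negligible_alt[of ?E]
  proof
    fix x assume "x \<in> ?E"
    then show "\<exists>U. openin (top_of_set ?E) U \<and> x \<in> U \<and> negligible U"
      using small[of "x - \<delta> / 4"] \<delta>(1)
      by (intro exI[of _ "?E \<inter> {x - \<delta> / 4<..<x - \<delta> / 4 + \<delta> / 2}"]) (auto intro!: openin_open_Int)
  qed
qed

text \<open>
  Letting one end of an interval around \<open>x\<close> tend to \<open>x\<close> turns bounds for slopes over intervals with
  \<open>x\<close> in the interior into bounds for difference quotients at \<open>x\<close>.
\<close>

lemma eventually_slope_le:
  assumes F: "continuous_on {c..d} F" and x: "x \<in> {c<..<d}" "x \<notin> steep_points F c d q"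
  shows "\<forall>\<^sub>F y in at x. (F y - F x) / (y - x) \<le> q"
proof -
  have "\<exists>\<delta>>0. \<forall>a b. c < a \<longrightarrow> a < x \<longrightarrow> x < b \<longrightarrow> b < d \<longrightarrow> b - a < \<delta> \<longrightarrow> F b - F a \<le> q * (b - a)"
    using x(2) unfolding steep_points_def mem_Collect_eq not_all not_imp not_ex not_less[symmetric] by blast
  then obtain \<delta> where \<delta>: "\<delta> > 0"
    "\<And>a b. c < a \<Longrightarrow> a < x \<Longrightarrow> x < b \<Longrightarrow> b < d \<Longrightarrow> b - a < \<delta> \<Longrightarrow> F b - F a \<le> q * (b - a)"
    by blast
  have Fx: "(F \<longlongrightarrow> F x) (at x)"
    using F x(1) continuous_on_interior[of "{c..d}" F x] by (simp add: continuous_at)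
  then have Fl: "(F \<longlongrightarrow> F x) (at_left x)" and Fr: "(F \<longlongrightarrow> F x) (at_right x)"
    by (simp_all add: filterlim_at_split)
  define \<eta> where "\<eta> = min (\<delta> / 2) (min (d - x) (x - c))"
  have \<eta>: "\<eta> > 0" using \<delta>(1) x(1) by (simp add: \<eta>_def)
  have right: "F y - F x \<le> q * (y - x)" if "x < y" "y < x + \<eta>" for y
  proof (rule tendsto_le)
    show "((\<lambda>a. F y - F a) \<longlongrightarrow> F y - F x) (at_left x)" by (intro tendsto_intros Fl)
    show "((\<lambda>a. q * (y - a)) \<longlongrightarrow> q * (y - x)) (at_left x)" by (intro tendsto_intros)
    have "\<forall>\<^sub>F a in at_left x. a \<in> {x - \<eta><..<x}"
      using \<eta> by (intro eventually_at_left_real) simp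
    then show "\<forall>\<^sub>F a in at_left x. F y - F a \<le> q * (y - a)"
      by eventually_elim (use that in \<open>auto intro!: \<delta>(2) simp: \<eta>_def\<close>)
  qed simp
  have left: "F x - F y \<le> q * (x - y)" if "x - \<eta> < y" "y < x" for y
  proof (rule tendsto_le)
    show "((\<lambda>b. F b - F y) \<longlongrightarrow> F x - F y) (at_right x)" by (intro tendsto_intros Fr)
    show "((\<lambda>b. q * (b - y)) \<longlongrightarrow> q * (x - y)) (at_right x)" by (intro tendsto_intros)
    have "\<forall>\<^sub>F b in at_right x. b \<in> {x<..<x + \<eta>}"
      using \<eta> by (intro eventually_at_right_real) simp
    then show "\<forall>\<^sub>F b in at_right x. F b - F y \<le> q * (b - y)"
      by eventually_elim (use that in \<open>auto intro!: \<delta>(2) simp: \<eta>_def\<close>)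
  qed simp
  have "(F y - F x) / (y - x) \<le> q" if "y \<noteq> x" "dist y x < \<eta>" for y
  proof (cases "x < y")
    case True
    then show ?thesis using right[of y] that by (simp add: divide_le_eq dist_real_def)
  next
    case False
    then have "y < x" using that by simp
    then show ?thesis using left[of y] that by (simp add: divide_le_eq dist_real_def algebra_simps)
  qed
  then show ?thesis using \<eta> by (auto simp: eventually_at intro!: exI[of _ \<eta>])
qed

text \<open>
  The derivative is the infimum of the \<open>q\<close> for which \<open>x\<close> is not steep. Every larger number is eventually
  above the difference quotients by definition; for a smaller number \<open>s\<close>, two rationals between \<open>s\<close> and
  the infimum and the hypothesis \<open>two\<close> show that it is eventually below them.
\<close>

lemma differentiable_if_slopes_converge:
  assumes F: "continuous_on {c..d} F" and x: "x \<in> {c<..<d}"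
    and two: "\<And>p q. p \<in> \<rat> \<Longrightarrow> q \<in> \<rat> \<Longrightarrow> p < q \<Longrightarrow>
      x \<notin> steep_points F c d q \<inter> steep_points (\<lambda>x. - F x) c d (- p)"
    and up: "x \<notin> (\<Inter>q. steep_points F c d q)"
    and down: "x \<notin> (\<Inter>q. steep_points (\<lambda>x. - F x) c d q)"
  shows "F differentiable (at x)"
proof -
  define A where "A = {q. x \<notin> steep_points F c d q}"
  have upper: "\<forall>\<^sub>F y in at x. (F y - F x) / (y - x) \<le> q" if "q \<in> A" for q
    using eventually_slope_le[OF F x] that by (simp add: A_def)
  have lower: "\<forall>\<^sub>F y in at x. (F y - F x) / (y - x) \<ge> p"
    if "x \<notin> steep_points (\<lambda>x. - F x) c d (- p)" for p
  proof -
    have "\<forall>\<^sub>F y in at x. (- F y - - F x) / (y - x) \<le> - p"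
      by (rule eventually_slope_le[OF continuous_on_minus[OF F] x that])
    then show ?thesis
      by eventually_elim (simp add: minus_divide_left[symmetric] diff_divide_distrib)
  qed
  have A: "A \<noteq> {}" using up by (auto simp: A_def)
  obtain P where P: "x \<notin> steep_points (\<lambda>x. - F x) c d (- P)"
    using down by (metis INT_I minus_minus)
  have "P \<le> q" if "q \<in> A" for q
  proof -
    have "\<forall>\<^sub>F y in at x. P \<le> q"
      using upper[OF that] lower[OF P] by eventually_elim linarith
    then show ?thesis by simp
  qed
  then have bdd: "bdd_below A" by (auto simp: bdd_below_def)
  have "((\<lambda>y. (F y - F x) / (y - x)) \<longlongrightarrow> Inf A) (at x)"
  proof (rule order_tendstoI)
    fix s assume "Inf A < s"
    then obtain q where "q \<in> A" "q < s" using cInf_lessD[OF A] by blast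
    then show "\<forall>\<^sub>F y in at x. (F y - F x) / (y - x) < s"
      using upper[OF \<open>q \<in> A\<close>] by (auto elim: eventually_mono)
  next
    fix s assume "s < Inf A"
    then obtain p where p: "p \<in> \<rat>" "s < p" "p < Inf A" using Rats_dense_in_real by blast
    obtain q where q: "q \<in> \<rat>" "p < q" "q < Inf A" using Rats_dense_in_real[OF p(3)] by blast
    have "q \<notin> A" using cInf_lower[OF _ bdd, of q] q by auto
    then have "x \<notin> steep_points (\<lambda>x. - F x) c d (- p)"
      using two[OF p(1) q(1,2)] by (simp add: A_def)
    from lower[OF this] show "\<forall>\<^sub>F y in at x. s < (F y - F x) / (y - x)"
      by eventually_elim (use p in linarith)
  qed
  then have "(F has_field_derivative Inf A) (at x)" by (simp add: has_field_derivative_iff)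
  then show ?thesis by (auto simp: real_differentiable_def)
qed

text \<open>
  Lebesgue's differentiation theorem for this class of functions. Rational \<open>p < q\<close> suffice to detect that
  the upper and the lower derivative differ, so countably many null sets have to be removed.
\<close>

theorem abs_continuous_on_imp_differentiable_ae:
  assumes F: "abs_continuous_on {c..d} F"
  obtains N where "negligible N" "\<And>x. x \<in> {c<..<d} - N \<Longrightarrow> F differentiable (at x)"
proof
  let ?S = "\<lambda>p q. steep_points F c d q \<inter> steep_points (\<lambda>x. - F x) c d (- p)"
  define N where "N = (\<Union>(p, q)\<in>{(p, q). p \<in> \<rat> \<and> q \<in> \<rat> \<and> p < q}. ?S p q) \<union>
    (\<Inter>q. steep_points F c d q) \<union> (\<Inter>q. steep_points (\<lambda>x. - F x) c d q)"
  have c: "countable {(p, q). p \<in> \<rat> \<and> q \<in> \<rat> \<and> p < (q :: real)}"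
    by (rule countable_subset[OF _ countable_SIGMA[OF countable_rat countable_rat]]) auto
  have "negligible (\<Union>(p, q)\<in>{(p, q). p \<in> \<rat> \<and> q \<in> \<rat> \<and> p < q}. ?S p q)"
  proof (rule negligible_countable_Union[OF countable_image[OF c]])
    fix S assume "S \<in> (\<lambda>(p, q). ?S p q) ` {(p, q). p \<in> \<rat> \<and> q \<in> \<rat> \<and> p < q}"
    then obtain p q where "S = ?S p q" "p < q" by auto
    then show "negligible S" using two_slopes_null[OF F] by blast
  qed
  then show "negligible N"
    unfolding N_def
    by (intro negligible_Un infinite_slope_null[OF F]
        infinite_slope_null[OF abs_continuous_on_minus[OF F]])
  fix x assume "x \<in> {c<..<d} - N"
  then show "F differentiable (at x)"
    using differentiable_if_slopes_converge[OF abs_continuous_on_imp_continuous_on[OF F], of x]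
    unfolding N_def by blast
qed

text \<open>
  The points of differentiability are covered by short intervals on which \<open>F\<close> changes by at most
  \<open>m + \<epsilon>\<close> times the length; the gaps between finitely many of them contribute less than \<open>\<epsilon>\<close>.
\<close>

lemma abs_continuous_on_increment_le:
  assumes F: "abs_continuous_on {a..b} F" and ab: "a \<le> b" and m: "m \<ge> 0" and N: "negligible N"
    and der: "\<And>x. x \<in> {a<..<b} - N \<Longrightarrow> \<exists>D. (F has_field_derivative D) (at x) \<and> \<bar>D\<bar> \<le> m"
  shows "\<bar>F b - F a\<bar> \<le> m * (b - a)"
proof (rule field_le_epsilon)
  fix e :: real assume "e > 0"
  define \<epsilon> where "\<epsilon> = e / (b - a + 1)"
  have \<epsilon>: "\<epsilon> > 0" "\<epsilon> * (b - a + 1) = e" using \<open>e > 0\<close> ab by (auto simp: \<epsilon>_def)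
  obtain \<delta> where \<delta>: "\<delta> > 0"
    "\<And>D. interval_system {a..b} D \<Longrightarrow> total_length D < \<delta> \<Longrightarrow> \<bar>increment F D\<bar> < \<epsilon>"
    using abs_continuous_on_increment[OF F \<epsilon>(1)] by blast
  let ?E = "{a<..<b} - N"
  have E: "?E \<in> lmeasurable" "measure lebesgue ?E = b - a"
  proof -
    have "negligible ({a<..<b} - ?E \<union> (?E - {a<..<b}))" by (rule negligible_subset[OF N]) auto
    then show "?E \<in> lmeasurable" "measure lebesgue ?E = b - a"
      using lmeasurable_negligible_symdiff[of "{a<..<b}" ?E] measure_negligible_symdiff[of "{a<..<b}" ?E] ab
      by auto
  qed
  obtain D where D: "interval_system {a<..<b} D"
    "\<And>u v. (u, v) \<in> D \<Longrightarrow> \<bar>F v - F u\<bar> \<le> (m + \<epsilon>) * (v - u)"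
    "total_length D > measure lebesgue ?E - \<delta>"
  proof (rule Vitali_interval_system[OF E(1), of "{a<..<b}" \<delta> "\<lambda>u v. \<bar>F v - F u\<bar> \<le> (m + \<epsilon>) * (v - u)"])
    fix x \<eta> :: real assume "x \<in> ?E" "\<eta> > 0"
    then obtain L where L: "(F has_field_derivative L) (at x)" "\<bar>L\<bar> \<le> m" using der by blast
    then obtain \<rho> where \<rho>: "\<rho> > 0" "\<And>y. \<bar>y - x\<bar> < \<rho> \<Longrightarrow> \<bar>F y - F x - L * (y - x)\<bar> \<le> \<epsilon> * \<bar>y - x\<bar>"
      using \<epsilon>(1) unfolding has_field_derivative_def has_derivative_at_alt by auto
    have near: "\<bar>F y - F x\<bar> \<le> (m + \<epsilon>) * \<bar>y - x\<bar>" if "\<bar>y - x\<bar> < \<rho>" for y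
    proof -
      have "\<bar>F y - F x\<bar> \<le> \<bar>L * (y - x)\<bar> + \<epsilon> * \<bar>y - x\<bar>" using \<rho>(2)[OF that] by linarith
      also have "\<dots> \<le> m * \<bar>y - x\<bar> + \<epsilon> * \<bar>y - x\<bar>"
        using L(2) by (simp add: abs_mult mult_right_mono)
      finally show ?thesis by (simp add: algebra_simps)
    qed
    define t where "t = min \<rho> \<eta> / 3"
    have t: "0 < t" "t < \<rho>" "2 * t < \<eta>" using \<rho>(1) \<open>\<eta> > 0\<close> by (auto simp: t_def)
    have "\<bar>F (x + t) - F x\<bar> \<le> (m + \<epsilon>) * t" "\<bar>F (x - t) - F x\<bar> \<le> (m + \<epsilon>) * t"
      using near[of "x + t"] near[of "x - t"] t by auto
    then have "\<bar>F (x + t) - F (x - t)\<bar> \<le> (m + \<epsilon>) * (x + t - (x - t))"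
      by (simp add: algebra_simps)
    then show "\<exists>u v. u < x \<and> x < v \<and> v - u < \<eta> \<and> \<bar>F v - F u\<bar> \<le> (m + \<epsilon>) * (v - u)"
      using t by (intro exI[of _ "x - t"] exI[of _ "x + t"]) auto
  qed (use \<delta>(1) that in auto)
  have D': "interval_system {a..b} D" by (rule interval_system_mono[OF D(1)]) auto
  obtain G where G: "interval_system {a..b} G" "\<And>F. increment F G = F b - F a - increment F D"
    using interval_system_complement[OF D' ab] by blast
  have "\<bar>increment F G\<bar> < \<epsilon>" using \<delta>(2)[OF G(1)] G(2)[of "\<lambda>x. x"] D(3) E(2) by simp
  moreover have "\<bar>increment F D\<bar> \<le> (m + \<epsilon>) * total_length D"
  proof -
    have "\<bar>increment F D\<bar> \<le> (\<Sum>(u, v)\<in>D. \<bar>F v - F u\<bar>)" by (rule abs_increment_le)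
    also have "\<dots> \<le> (\<Sum>(u, v)\<in>D. (m + \<epsilon>) * (v - u))"
      by (rule sum_mono) (use D(2) in auto)
    finally show ?thesis by (simp add: increment_def sum_distrib_left case_prod_beta)
  qed
  moreover have "(m + \<epsilon>) * total_length D \<le> (m + \<epsilon>) * (b - a)"
    using total_length_le[OF D', of "{a..b}"] ab m \<epsilon>(1) by (intro mult_left_mono) auto
  ultimately have "\<bar>F b - F a\<bar> \<le> (m + \<epsilon>) * (b - a) + \<epsilon>" using G(2)[of F] by linarith
  then show "\<bar>F b - F a\<bar> \<le> m * (b - a) + e" using \<epsilon>(2) by (simp add: algebra_simps)
qed

section \<open>The weighted spaces in terms of Lipschitz bounds\<close>

definition boundary_weight :: "nat \<Rightarrow> real \<Rightarrow> real"
  where "boundary_weight r y = inverse (sqrt (1 - y\<^sup>2) ^ r)"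

text \<open>
  The integrated form of \<open>\<bar>\<Phi>'\<bar> \<le> C * boundary_weight r\<close>: on \<open>{a..b}\<close> the weight is largest at an end point.
\<close>

definition weighted_Lipschitz :: "nat \<Rightarrow> real \<Rightarrow> (real \<Rightarrow> real) \<Rightarrow> bool"
  where "weighted_Lipschitz r C \<Phi> \<longleftrightarrow> (\<forall>a b. -1 < a \<longrightarrow> a \<le> b \<longrightarrow> b < 1 \<longrightarrow>
    \<bar>\<Phi> b - \<Phi> a\<bar> \<le> C * max (boundary_weight r a) (boundary_weight r b) * (b - a))"

definition smooth_below :: "nat \<Rightarrow> (real \<Rightarrow> real) \<Rightarrow> bool"
  where "smooth_below n f \<longleftrightarrow> (\<forall>j<n. \<forall>y\<in>{-1<..<1}. (deriv ^^ j) f differentiable (at y))"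

lemma one_minus_square_pos: "-1 < y \<Longrightarrow> y < 1 \<Longrightarrow> 0 < 1 - y\<^sup>2" for y :: real
  by (simp add: abs_square_less_1)

lemma boundary_weight_pos: "-1 < y \<Longrightarrow> y < 1 \<Longrightarrow> 0 < boundary_weight r y"
  using one_minus_square_pos[of y] by (simp add: boundary_weight_def)

lemma boundary_weight_mult:
  "-1 < y \<Longrightarrow> y < 1 \<Longrightarrow> boundary_weight r y * sqrt (1 - y\<^sup>2) ^ r = 1"
  using one_minus_square_pos[of y] by (simp add: boundary_weight_def)

lemma boundary_weight_le_max:
  assumes "-1 < a" "a \<le> y" "y \<le> b" "b < 1"
  shows "boundary_weight r y \<le> max (boundary_weight r a) (boundary_weight r b)"
proof -
  have mono: "boundary_weight r y \<le> boundary_weight r z" if "y\<^sup>2 \<le> z\<^sup>2" "-1 < z" "z < 1" for z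
    unfolding boundary_weight_def using one_minus_square_pos[OF that(2,3)] that(1)
    by (intro le_imp_inverse_le power_mono) auto
  show ?thesis
  proof (cases "0 \<le> y")
    case True
    then have "y\<^sup>2 \<le> b\<^sup>2" using assms by (intro power_mono) auto
    then show ?thesis using mono[of b] assms by simp
  next
    case False
    then have "(- y)\<^sup>2 \<le> (- a)\<^sup>2" using assms by (intro power_mono) auto
    then show ?thesis using mono[of a] assms by simp
  qed
qed

lemma continuous_on_boundary_weight: "continuous_on {-1<..<1} (boundary_weight r)"
proof -
  have "sqrt (1 - y\<^sup>2) ^ r \<noteq> 0" if "y \<in> {-1<..<1}" for y
    using one_minus_square_pos[of y] that by simp
  then show ?thesis unfolding boundary_weight_def by (intro continuous_intros) auto
qed

text \<open>
  The value of \<open>deriv \<Phi>\<close> at a point where \<open>\<Phi>\<close> is not differentiable carries no information, so the bound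
  can be used only because such points form a null set.
\<close>

lemma AC_open_imp_weighted_Lipschitz:
  assumes AC: "\<Phi> \<in> AC_open (-1) 1" and C: "C \<ge> 0"
    and ae: "AE y in lebesgue_on {-1<..<1}. \<bar>deriv \<Phi> y * sqrt (1 - y\<^sup>2) ^ r\<bar> \<le> C"
  shows "weighted_Lipschitz r C \<Phi>"
  unfolding weighted_Lipschitz_def
proof (intro allI impI)
  fix a b :: real assume ab: "-1 < a" "a \<le> b" "b < 1"
  let ?W = "max (boundary_weight r a) (boundary_weight r b)"
  show "\<bar>\<Phi> b - \<Phi> a\<bar> \<le> C * ?W * (b - a)"
  proof (cases "a = b")
    case False
    then have F: "abs_continuous_on {a..b} \<Phi>" using AC ab by (simp add: AC_open_def)
    obtain N1 where N1: "negligible N1" "\<And>x. x \<in> {a<..<b} - N1 \<Longrightarrow> \<Phi> differentiable (at x)"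
      using abs_continuous_on_imp_differentiable_ae[OF F] by blast
    have "AE y in lebesgue. y \<in> {-1<..<1} \<longrightarrow> \<bar>deriv \<Phi> y * sqrt (1 - y\<^sup>2) ^ r\<bar> \<le> C"
      using ae by (subst (asm) AE_restrict_space_iff) auto
    then obtain N2 where N2: "N2 \<in> null_sets lebesgue"
      "{y \<in> space lebesgue. \<not> (y \<in> {-1<..<1} \<longrightarrow> \<bar>deriv \<Phi> y * sqrt (1 - y\<^sup>2) ^ r\<bar> \<le> C)} \<subseteq> N2"
      unfolding eventually_ae_filter by blast
    show ?thesis
    proof (rule abs_continuous_on_increment_le[OF F ab(2)])
      show "0 \<le> C * ?W" using C boundary_weight_pos[of a r] ab by (simp add: max_def)
      show "negligible (N1 \<union> N2)" using N1(1) N2(1) by (intro negligible_Un) (simp_all add: negligible_iff_null_sets)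
      fix x assume x: "x \<in> {a<..<b} - (N1 \<union> N2)"
      then have x1: "-1 < x" "x < 1" using ab by auto
      have D: "(\<Phi> has_field_derivative deriv \<Phi> x) (at x)"
        using N1(2)[of x] x by (simp add: DERIV_deriv_iff_real_differentiable)
      have "\<bar>deriv \<Phi> x * sqrt (1 - x\<^sup>2) ^ r\<bar> \<le> C" using N2(2) x x1 by auto
      then have "boundary_weight r x * \<bar>deriv \<Phi> x * sqrt (1 - x\<^sup>2) ^ r\<bar> \<le> boundary_weight r x * C"
        using boundary_weight_pos[OF x1, of r] by (intro mult_left_mono) auto
      moreover have "boundary_weight r x * \<bar>deriv \<Phi> x * sqrt (1 - x\<^sup>2) ^ r\<bar> =
          \<bar>deriv \<Phi> x\<bar> * (boundary_weight r x * sqrt (1 - x\<^sup>2) ^ r)"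
        using one_minus_square_pos[OF x1] by (simp add: abs_mult power_abs)
      ultimately have "\<bar>deriv \<Phi> x\<bar> \<le> boundary_weight r x * C"
        using boundary_weight_mult[OF x1, of r] by simp
      also have "\<dots> \<le> ?W * C"
        using boundary_weight_le_max[of a x b r] C ab x by (intro mult_right_mono) auto
      finally show "\<exists>D. (\<Phi> has_field_derivative D) (at x) \<and> \<bar>D\<bar> \<le> C * ?W"
        using D by (auto simp: mult.commute)
    qed
  qed simp
qed

lemma weighted_Lipschitz_bound:
  assumes L: "weighted_Lipschitz r C \<Phi>" and C: "C \<ge> 0" and cd: "-1 < c" "d < 1"
    and a: "a \<in> {c..d}" and b: "b \<in> {c..d}"
  shows "\<bar>\<Phi> b - \<Phi> a\<bar> \<le> C * max (boundary_weight r c) (boundary_weight r d) * \<bar>b - a\<bar>"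
proof -
  let ?W = "max (boundary_weight r c) (boundary_weight r d)"
  have ordered: "\<bar>\<Phi> y - \<Phi> x\<bar> \<le> C * ?W * (y - x)" if "c \<le> x" "x \<le> y" "y \<le> d" for x y
  proof -
    have "\<bar>\<Phi> y - \<Phi> x\<bar> \<le> C * max (boundary_weight r x) (boundary_weight r y) * (y - x)"
      using L that cd unfolding weighted_Lipschitz_def by simp
    also have "\<dots> \<le> C * ?W * (y - x)"
      using that cd C by (intro mult_right_mono mult_left_mono max.boundedI boundary_weight_le_max) auto
    finally show ?thesis .
  qed
  show ?thesis
    using ordered[of a b] ordered[of b a] a b by (cases "a \<le> b") (auto simp: abs_minus_commute)
qed

lemma weighted_Lipschitz_imp_AC_open:
  assumes L: "weighted_Lipschitz r C \<Phi>" and C: "C \<ge> 0"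
  shows "\<Phi> \<in> AC_open (-1) 1"
  unfolding AC_open_def abs_continuous_on_def
proof (intro CollectI allI impI, elim conjE)
  fix c d \<epsilon> :: real assume cd: "-1 < c" "c < d" "d < 1" and \<epsilon>: "0 < \<epsilon>"
  \<comment> \<open>The summand \<open>1\<close> makes \<open>K\<close> positive, as \<open>C\<close> may be zero.\<close>
  define K where "K = C * max (boundary_weight r c) (boundary_weight r d) + 1"
  have K: "K > 0"
    using C boundary_weight_pos[of c r] cd by (simp add: K_def add_nonneg_pos max_def)
  have bound: "\<bar>\<Phi> b - \<Phi> a\<bar> \<le> K * (b - a)" if "a \<le> b" "{a..b} \<subseteq> {c..d}" for a b
  proof -
    have "\<bar>\<Phi> b - \<Phi> a\<bar> \<le> (K - 1) * \<bar>b - a\<bar>"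
      using weighted_Lipschitz_bound[OF L C cd(1,3), of a b] that by (simp add: K_def)
    also have "\<dots> \<le> K * (b - a)" using that by (simp add: algebra_simps)
    finally show ?thesis .
  qed
  show "\<exists>\<delta>>0. \<forall>D. finite D \<and> (\<forall>(a, b)\<in>D. a \<le> b \<and> {a..b} \<subseteq> {c..d}) \<and>
      disjoint_family_on (\<lambda>(a, b). {a<..<b}) D \<and> (\<Sum>(a, b)\<in>D. b - a) < \<delta>
      \<longrightarrow> (\<Sum>(a, b)\<in>D. \<bar>\<Phi> b - \<Phi> a\<bar>) < \<epsilon>"
  proof (intro exI[of _ "\<epsilon> / K"] conjI allI impI)
    fix D :: "(real \<times> real) set"
    assume "finite D \<and> (\<forall>(a, b)\<in>D. a \<le> b \<and> {a..b} \<subseteq> {c..d}) \<and>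
      disjoint_family_on (\<lambda>(a, b). {a<..<b}) D \<and> (\<Sum>(a, b)\<in>D. b - a) < \<epsilon> / K"
    then have D: "\<forall>(a, b)\<in>D. a \<le> b \<and> {a..b} \<subseteq> {c..d}" "(\<Sum>(a, b)\<in>D. b - a) < \<epsilon> / K"
      by blast+
    have "(\<Sum>(a, b)\<in>D. \<bar>\<Phi> b - \<Phi> a\<bar>) \<le> (\<Sum>(a, b)\<in>D. K * (b - a))"
      unfolding case_prod_beta
    proof (rule sum_mono)
      fix i assume "i \<in> D"
      from bspec[OF D(1) this] have "fst i \<le> snd i \<and> {fst i..snd i} \<subseteq> {c..d}"
        by (simp add: case_prod_beta del: atLeastatMost_subset_iff)
      then show "\<bar>\<Phi> (snd i) - \<Phi> (fst i)\<bar> \<le> K * (snd i - fst i)" using bound by blast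
    qed
    also have "\<dots> = K * (\<Sum>(a, b)\<in>D. b - a)" by (simp add: sum_distrib_left case_prod_beta)
    also have "\<dots> < \<epsilon>" using D(2) K by (simp add: pos_less_divide_eq mult.commute)
    finally show "(\<Sum>(a, b)\<in>D. \<bar>\<Phi> b - \<Phi> a\<bar>) < \<epsilon>" .
  qed (use \<epsilon> K in simp)
qed

text \<open>
  The interval is exhausted by countably many compact ones.
\<close>

lemma AC_open_differentiable_ae:
  assumes "\<Phi> \<in> AC_open (-1) 1"
  obtains N where "negligible N" "\<And>x. x \<in> {-1<..<1} - N \<Longrightarrow> \<Phi> differentiable (at x)"
proof -
  define e where "e n = 1 - inverse (real (Suc (Suc n)))" for n
  have e: "0 < e n" "e n < 1" for n by (auto simp: e_def field_simps)
  have "\<exists>N. negligible N \<and> (\<forall>x \<in> {- e n<..<e n} - N. \<Phi> differentiable (at x))" for n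
  proof -
    have "abs_continuous_on {- e n..e n} \<Phi>" using assms e[of n] by (simp add: AC_open_def)
    then show ?thesis using abs_continuous_on_imp_differentiable_ae by metis
  qed
  then obtain N where N: "\<And>n. negligible (N n)"
    "\<And>n x. x \<in> {- e n<..<e n} - N n \<Longrightarrow> \<Phi> differentiable (at x)" by metis
  show thesis
  proof (rule that)
    show "negligible (\<Union>n. N n)" using N(1) by (intro negligible_countable_Union) auto
    fix x assume x: "x \<in> {-1<..<1} - (\<Union>n. N n)"
    then have "0 < 1 - \<bar>x\<bar>" by auto
    then obtain n where n: "inverse (real (Suc n)) < 1 - \<bar>x\<bar>" using reals_Archimedean by blast
    have "inverse (real (Suc (Suc n))) \<le> inverse (real (Suc n))" by (simp add: field_simps)
    then have "\<bar>x\<bar> < e n" using n unfolding e_def by linarith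
    then have "x \<in> {- e n<..<e n} - N n" using x by auto
    then show "\<Phi> differentiable (at x)" by (rule N(2))
  qed
qed

text \<open>
  Almost everywhere the derivative is the limit of the measurable difference quotients with step
  \<open>1 / (n + 1)\<close>, where \<open>\<Phi>\<close> is continued by zero because the shifted argument may leave the interval.
\<close>

lemma deriv_measurable:
  assumes cont: "continuous_on {-1<..<1} \<Phi>"
    and N: "negligible N" "\<And>x. x \<in> {-1<..<1} - N \<Longrightarrow> \<Phi> differentiable (at x)"
  shows "deriv \<Phi> \<in> borel_measurable (lebesgue_on {-1<..<1::real})"
proof -
  define \<Phi>0 where "\<Phi>0 y = (if y \<in> {-1<..<1} then \<Phi> y else 0)" for y
  have [measurable]: "\<Phi>0 \<in> borel_measurable borel"
    unfolding \<Phi>0_def by (intro borel_measurable_continuous_on_if cont) auto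
  define h where "h n = inverse (real (Suc n))" for n
  have h: "h \<longlonglongrightarrow> 0" "\<And>n. h n > 0" unfolding h_def by (rule LIMSEQ_inverse_real_of_nat) simp
  define Q where "Q n y = (\<Phi>0 (y + h n) - \<Phi>0 y) / h n" for n y
  have Qb: "Q n \<in> borel_measurable borel" for n unfolding Q_def by measurable
  have Qm: "Q n measurable_on {-1<..<1}" for n
  proof -
    have "Q n \<in> borel_measurable (lebesgue_on {-1<..<1})"
      using Qb[of n] by (intro measurable_restrict_space1 measurable_completion) simp
    then show ?thesis by (simp add: measurable_on_iff_borel_measurable)
  qed
  have "deriv \<Phi> measurable_on {-1<..<1}"
  proof (rule measurable_on_limit[OF Qm N(1)])
    fix x assume x: "x \<in> {-1<..<1} - N"
    have "(\<Phi> has_field_derivative deriv \<Phi> x) (at x)"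
      using N(2)[OF x] by (simp add: DERIV_deriv_iff_real_differentiable)
    then have lim: "((\<lambda>t. (\<Phi> (x + t) - \<Phi> x) / t) \<longlongrightarrow> deriv \<Phi> x) (at 0)"
      by (simp add: DERIV_def)
    have "filterlim h (at 0) sequentially"
      using h by (intro filterlim_atI) (auto intro!: always_eventually simp: less_imp_neq[OF h(2), symmetric])
    from filterlim_compose[OF lim this]
    have "(\<lambda>n. (\<Phi> (x + h n) - \<Phi> x) / h n) \<longlonglongrightarrow> deriv \<Phi> x" .
    moreover have "\<forall>\<^sub>F n in sequentially. h n < 1 - x"
      using order_tendstoD(2)[OF h(1), of "1 - x"] x by simp
    then have "\<forall>\<^sub>F n in sequentially. (\<Phi> (x + h n) - \<Phi> x) / h n = Q n x"
    proof eventually_elim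
      case (elim n)
      then show ?case using x h(2)[of n] by (simp add: Q_def \<Phi>0_def)
    qed
    ultimately show "(\<lambda>n. Q n x) \<longlonglongrightarrow> deriv \<Phi> x" using tendsto_cong by fast
  qed
  then show ?thesis by (simp add: measurable_on_iff_borel_measurable)
qed

lemma weighted_Lipschitz_deriv_le:
  assumes L: "weighted_Lipschitz r C \<Phi>" and C: "C \<ge> 0" and y: "-1 < y" "y < 1"
    and D: "(\<Phi> has_field_derivative D) (at y)"
  shows "\<bar>D\<bar> \<le> C * boundary_weight r y"
proof (rule tendsto_le)
  have "((\<lambda>z. (\<Phi> z - \<Phi> y) / (z - y)) \<longlongrightarrow> D) (at_right y)"
    using has_field_derivative_at_within[OF D, of "{y<..}"] by (simp add: has_field_derivative_iff)
  then show "((\<lambda>z. \<bar>(\<Phi> z - \<Phi> y) / (z - y)\<bar>) \<longlongrightarrow> \<bar>D\<bar>) (at_right y)" by (rule tendsto_rabs)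
  have "isCont (boundary_weight r) y"
    using continuous_on_boundary_weight y by (simp add: continuous_on_eq_continuous_at)
  then have "(boundary_weight r \<longlongrightarrow> boundary_weight r y) (at_right y)"
    by (simp add: isCont_def filterlim_at_split)
  then have "((\<lambda>z. C * max (boundary_weight r y) (boundary_weight r z)) \<longlongrightarrow>
      C * max (boundary_weight r y) (boundary_weight r y)) (at_right y)"
    by (intro tendsto_intros)
  then show "((\<lambda>z. C * max (boundary_weight r y) (boundary_weight r z)) \<longlongrightarrow>
      C * boundary_weight r y) (at_right y)" by simp
  have "\<forall>\<^sub>F z in at_right y. z \<in> {y<..<1}" using y by (intro eventually_at_right_real)
  then show "\<forall>\<^sub>F z in at_right y.
      \<bar>(\<Phi> z - \<Phi> y) / (z - y)\<bar> \<le> C * max (boundary_weight r y) (boundary_weight r z)"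
  proof eventually_elim
    case (elim z)
    then have "\<bar>\<Phi> z - \<Phi> y\<bar> \<le> C * max (boundary_weight r y) (boundary_weight r z) * (z - y)"
      using L y unfolding weighted_Lipschitz_def by simp
    then show ?case using elim by (simp add: abs_divide divide_le_eq)
  qed
qed simp

text \<open>
  Measurability matters here, as the essential supremum of a non-measurable function is infinite.
\<close>

lemma weighted_seminorm_finite:
  assumes r: "r \<ge> 1" and L: "weighted_Lipschitz r C (nth_deriv (r - 1) f)" and C: "C \<ge> 0"
  shows "weighted_seminorm r f < \<infinity>"
proof -
  let ?\<Phi> = "nth_deriv (r - 1) f"
  have AC: "?\<Phi> \<in> AC_open (-1) 1" by (rule weighted_Lipschitz_imp_AC_open[OF L C])
  obtain N where N: "negligible N" "\<And>x. x \<in> {-1<..<1} - N \<Longrightarrow> ?\<Phi> differentiable (at x)"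
    using AC_open_differentiable_ae[OF AC] by blast
  have eq: "nth_deriv r f = deriv ?\<Phi>"
    using r by (cases r) (auto simp: nth_deriv_def)
  have cont: "continuous_on {-1<..<1} ?\<Phi>"
  proof -
    have "isCont ?\<Phi> x" if x: "x \<in> {-1<..<1}" for x
    proof -
      have "abs_continuous_on {(x - 1) / 2..(x + 1) / 2} ?\<Phi>"
        using AC x by (auto simp: AC_open_def)
      from abs_continuous_on_imp_continuous_on[OF this]
      show ?thesis using x by (intro continuous_on_interior[of "{(x - 1) / 2..(x + 1) / 2}"]) auto
    qed
    then show ?thesis by (intro continuous_at_imp_continuous_on) auto
  qed
  have "(\<lambda>x. sqrt (1 - x\<^sup>2) ^ r) \<in> borel_measurable (lebesgue_on {-1<..<1::real})"
    by (intro measurable_restrict_space1 measurable_completion) simp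
  then have meas: "(\<lambda>x. ereal \<bar>nth_deriv r f x * sqrt (1 - x\<^sup>2) ^ r\<bar>)
      \<in> borel_measurable (lebesgue_on {-1<..<1})"
    using deriv_measurable[OF cont N] unfolding eq
    by (intro borel_measurable_ereal borel_measurable_abs borel_measurable_times)
  have "AE x in lebesgue_on {-1<..<1}. ereal \<bar>nth_deriv r f x * sqrt (1 - x\<^sup>2) ^ r\<bar> \<le> ereal C"
  proof (subst AE_restrict_space_iff, simp, rule AE_I')
    show "N \<in> null_sets lebesgue" using N(1) by (simp add: negligible_iff_null_sets)
    show "{x \<in> space lebesgue. \<not> (x \<in> {-1<..<1} \<longrightarrow>
        ereal \<bar>nth_deriv r f x * sqrt (1 - x\<^sup>2) ^ r\<bar> \<le> ereal C)} \<subseteq> N"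
    proof (clarify, rule ccontr)
      fix x assume x: "x \<in> {-1<..<1::real}" "x \<notin> N"
        and not_le: "\<not> ereal \<bar>nth_deriv r f x * sqrt (1 - x\<^sup>2) ^ r\<bar> \<le> ereal C"
      have x1: "-1 < x" "x < 1" using x by auto
      have "(?\<Phi> has_field_derivative deriv ?\<Phi> x) (at x)"
        using N(2)[of x] x by (simp add: DERIV_deriv_iff_real_differentiable)
      from weighted_Lipschitz_deriv_le[OF L C x1 this]
      have "\<bar>deriv ?\<Phi> x\<bar> * sqrt (1 - x\<^sup>2) ^ r \<le> C * boundary_weight r x * sqrt (1 - x\<^sup>2) ^ r"
        using one_minus_square_pos[OF x1] by (intro mult_right_mono) auto
      also have "\<dots> = C" using boundary_weight_mult[OF x1, of r] by (simp add: mult.assoc)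
      finally show False
        using not_le one_minus_square_pos[OF x1] by (simp add: eq abs_mult power_abs)
    qed
  qed
  then have "weighted_seminorm r f \<le> ereal C"
    unfolding weighted_seminorm_def by (rule esssup_I[OF meas])
  then show ?thesis by (rule order.strict_trans1) simp
qed

lemma W_spaceI:
  fixes f :: C0
  assumes "r \<ge> 1" "smooth_below (r - 1) (\<lambda>y. f (to_icc y))"
    "weighted_Lipschitz r C (nth_deriv (r - 1) f)" "C \<ge> 0"
  shows "f \<in> W_space r"
  using assms weighted_seminorm_finite weighted_Lipschitz_imp_AC_open
  unfolding W_space_def smooth_below_def nth_deriv_def by blast

lemma W_spaceD:
  fixes f :: C0
  assumes r: "r \<ge> 1" and f: "f \<in> W_space r"
  shows "smooth_below (r - 1) (\<lambda>y. f (to_icc y))"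
    and "weighted_seminorm r f \<le> ereal C \<Longrightarrow> C \<ge> 0 \<Longrightarrow> weighted_Lipschitz r C (nth_deriv (r - 1) f)"
proof -
  show "smooth_below (r - 1) (\<lambda>y. f (to_icc y))"
    using f unfolding W_space_def smooth_below_def nth_deriv_def by blast
  assume le: "weighted_seminorm r f \<le> ereal C" and "C \<ge> 0"
  have "AE x in lebesgue_on {-1<..<1}. ereal \<bar>nth_deriv r f x * sqrt (1 - x\<^sup>2) ^ r\<bar> \<le> ereal C"
    using esssup_AE[where M = "lebesgue_on {-1<..<1}" and f = "\<lambda>x. ereal \<bar>nth_deriv r f x * sqrt (1 - x\<^sup>2) ^ r\<bar>"] le
    unfolding weighted_seminorm_def by (elim eventually_mono) (rule order_trans)
  moreover have "nth_deriv r f = deriv (nth_deriv (r - 1) f)"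
    using r by (cases r) (auto simp: nth_deriv_def)
  ultimately show "weighted_Lipschitz r C (nth_deriv (r - 1) f)"
    using f \<open>C \<ge> 0\<close> by (intro AC_open_imp_weighted_Lipschitz) (auto simp: W_space_def)
qed

lemma weighted_seminorm_nonneg: "0 \<le> weighted_seminorm r f"
proof -
  have "emeasure (lebesgue_on {-1<..<1}) (space (lebesgue_on {-1<..<1::real})) \<noteq> 0"
    by (simp add: emeasure_restrict_space)
  then have "0 = esssup (lebesgue_on {-1<..<1::real}) (\<lambda>x. 0 :: ereal)"
    by (simp add: esssup_const)
  also have "\<dots> \<le> weighted_seminorm r f"
    unfolding weighted_seminorm_def by (rule esssup_mono) auto
  finally show ?thesis .
qed

section \<open>Uniform bounds for derivatives of intermediate order\<close>

lemma smooth_belowD: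
  assumes "smooth_below n f" "j < n" "-1 < y" "y < 1"
  shows "((deriv ^^ j) f has_field_derivative (deriv ^^ Suc j) f y) (at y)"
  using assms by (simp add: smooth_below_def DERIV_deriv_iff_real_differentiable)

lemma smooth_below_mono: "smooth_below n f \<Longrightarrow> m \<le> n \<Longrightarrow> smooth_below m f"
  by (simp add: smooth_below_def)

lemma smooth_below_MVT:
  assumes f: "smooth_below n f" "j < n" and ab: "-1 < a" "a < b" "b < 1"
  obtains z where "a < z" "z < b" "(deriv ^^ j) f b - (deriv ^^ j) f a = (b - a) * (deriv ^^ Suc j) f z"
proof -
  have "\<exists>z. a < z \<and> z < b \<and> (deriv ^^ j) f b - (deriv ^^ j) f a = (b - a) * (deriv ^^ Suc j) f z"
  proof (rule MVT2[OF ab(2)])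
    fix x assume "a \<le> x" "x \<le> b"
    then show "((deriv ^^ j) f has_field_derivative (deriv ^^ Suc j) f x) (at x)"
      using ab by (intro smooth_belowD[OF f]) auto
  qed
  then show thesis using that by blast
qed

text \<open>
  If the derivative of order \<open>n\<close> is at most \<open>B1\<close> at some point of the first third of the interval and at
  most \<open>B2\<close> at some point of the last third, in absolute value, the mean value theorem gives a point
  between them where the next derivative is at most \<open>(B1 + B2) / ((d - c) / 3)\<close>.
\<close>

lemma exists_bounded_derivative:
  assumes "-1 < c" "c < d" "d < 1"
  shows "\<exists>B. \<forall>f. smooth_below n f \<longrightarrow> (\<forall>y\<in>{c..d}. \<bar>f y\<bar> \<le> M) \<longrightarrow>
    (\<exists>\<xi>\<in>{c..d}. \<bar>(deriv ^^ n) f \<xi>\<bar> \<le> B)"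
  using assms
proof (induction n arbitrary: c d)
  case 0
  then show ?case by (intro exI[of _ M]) force
next
  case (Suc n)
  define t where "t = (d - c) / 3"
  have t: "t > 0" "c + t < d - t" "d = c + 3 * t" using Suc.prems by (auto simp: t_def field_simps)
  obtain B1 where B1: "\<And>f. smooth_below n f \<Longrightarrow> (\<forall>y\<in>{c..c + t}. \<bar>f y\<bar> \<le> M) \<Longrightarrow>
      \<exists>\<xi>\<in>{c..c + t}. \<bar>(deriv ^^ n) f \<xi>\<bar> \<le> B1"
    using Suc.IH[of c "c + t"] Suc.prems t by auto
  obtain B2 where B2: "\<And>f. smooth_below n f \<Longrightarrow> (\<forall>y\<in>{d - t..d}. \<bar>f y\<bar> \<le> M) \<Longrightarrow>
      \<exists>\<xi>\<in>{d - t..d}. \<bar>(deriv ^^ n) f \<xi>\<bar> \<le> B2"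
    using Suc.IH[of "d - t" d] Suc.prems t by auto
  show ?case
  proof (intro exI[of _ "(B1 + B2) / t"] allI impI)
    fix f assume f: "smooth_below (Suc n) f" "\<forall>y\<in>{c..d}. \<bar>f y\<bar> \<le> M"
    have f': "smooth_below n f" by (rule smooth_below_mono[OF f(1)]) simp
    obtain \<xi>1 where \<xi>1: "\<xi>1 \<in> {c..c + t}" "\<bar>(deriv ^^ n) f \<xi>1\<bar> \<le> B1"
      using B1[OF f'] f(2) t by force
    obtain \<xi>2 where \<xi>2: "\<xi>2 \<in> {d - t..d}" "\<bar>(deriv ^^ n) f \<xi>2\<bar> \<le> B2"
      using B2[OF f'] f(2) t by force
    have lt: "-1 < \<xi>1" "\<xi>1 < \<xi>2" "\<xi>2 < 1" and gap: "t \<le> \<xi>2 - \<xi>1"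
      using \<xi>1 \<xi>2 t Suc.prems by auto
    obtain z where z: "\<xi>1 < z" "z < \<xi>2"
      "(deriv ^^ n) f \<xi>2 - (deriv ^^ n) f \<xi>1 = (\<xi>2 - \<xi>1) * (deriv ^^ Suc n) f z"
      using smooth_below_MVT[OF f(1) _ lt] by blast
    have "t * \<bar>(deriv ^^ Suc n) f z\<bar> \<le> \<bar>(\<xi>2 - \<xi>1) * (deriv ^^ Suc n) f z\<bar>"
      unfolding abs_mult using gap by (intro mult_right_mono) auto
    also have "\<dots> \<le> B1 + B2" unfolding z(3)[symmetric] using \<xi>1 \<xi>2 by linarith
    finally have "\<bar>(deriv ^^ Suc n) f z\<bar> \<le> (B1 + B2) / t"
      using t by (simp add: pos_le_divide_eq mult.commute)
    moreover have "z \<in> {c..d}" using z \<xi>1 \<xi>2 by auto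
    ultimately show "\<exists>\<xi>\<in>{c..d}. \<bar>(deriv ^^ Suc n) f \<xi>\<bar> \<le> (B1 + B2) / t" by blast
  qed
qed

text \<open>
  Downwards induction on the order: a Lipschitz constant for the derivative of order \<open>j + 1\<close>, together
  with one point where this derivative is not large, bounds it on the whole interval, and the bound is a
  Lipschitz constant for the derivative of order \<open>j\<close>.
\<close>

lemma uniform_Lipschitz_derivatives:
  fixes G :: "(real \<Rightarrow> real) set"
  assumes smooth: "\<And>f. f \<in> G \<Longrightarrow> smooth_below n f"
    and M: "\<And>f y. f \<in> G \<Longrightarrow> -1 < y \<Longrightarrow> y < 1 \<Longrightarrow> \<bar>f y\<bar> \<le> M"
    and L: "\<And>f. f \<in> G \<Longrightarrow> weighted_Lipschitz r C ((deriv ^^ n) f)" and C: "C \<ge> 0"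
    and cd: "-1 < c" "c < d" "d < 1" and j: "j \<le> n"
  shows "\<exists>K. \<forall>f\<in>G. \<forall>a\<in>{c..d}. \<forall>b\<in>{c..d}. \<bar>(deriv ^^ j) f b - (deriv ^^ j) f a\<bar> \<le> K * \<bar>b - a\<bar>"
  using j
proof (induction rule: inc_induct)
  case base
  show ?case
    using weighted_Lipschitz_bound[OF L C cd(1,3)] by blast
next
  case (step j)
  then obtain K where K: "\<And>f a b. f \<in> G \<Longrightarrow> a \<in> {c..d} \<Longrightarrow> b \<in> {c..d} \<Longrightarrow>
      \<bar>(deriv ^^ Suc j) f b - (deriv ^^ Suc j) f a\<bar> \<le> K * \<bar>b - a\<bar>" by blast
  obtain B where B: "\<And>f. smooth_below (Suc j) f \<Longrightarrow> (\<forall>y\<in>{c..d}. \<bar>f y\<bar> \<le> M) \<Longrightarrow>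
      \<exists>\<xi>\<in>{c..d}. \<bar>(deriv ^^ Suc j) f \<xi>\<bar> \<le> B"
    using exists_bounded_derivative[OF cd, of "Suc j" M] by blast
  define K' where "K' = B + \<bar>K\<bar> * (d - c)"
  have bound: "\<bar>(deriv ^^ Suc j) f y\<bar> \<le> K'" if f: "f \<in> G" and y: "y \<in> {c..d}" for f y
  proof -
    have "smooth_below (Suc j) f" using smooth_below_mono[OF smooth[OF f]] step by simp
    moreover have "\<forall>y\<in>{c..d}. \<bar>f y\<bar> \<le> M" using M[OF f] cd by auto
    ultimately obtain \<xi> where \<xi>: "\<xi> \<in> {c..d}" "\<bar>(deriv ^^ Suc j) f \<xi>\<bar> \<le> B" using B by blast
    have "K * \<bar>y - \<xi>\<bar> \<le> \<bar>K\<bar> * (d - c)" using y \<xi> by (intro mult_mono) auto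
    then show ?thesis using K[OF f \<xi>(1) y] \<xi>(2) by (simp add: K'_def)
  qed
  have less: "\<bar>(deriv ^^ j) f b - (deriv ^^ j) f a\<bar> \<le> K' * \<bar>b - a\<bar>"
    if f: "f \<in> G" and ab: "c \<le> a" "a < b" "b \<le> d" for f a b
  proof -
    obtain z where z: "a < z" "z < b" "(deriv ^^ j) f b - (deriv ^^ j) f a = (b - a) * (deriv ^^ Suc j) f z"
      using smooth_below_MVT[OF smooth[OF f], of j a b] step ab cd by auto
    have "\<bar>(deriv ^^ Suc j) f z\<bar> \<le> K'" using z ab by (intro bound f) auto
    then have "\<bar>b - a\<bar> * \<bar>(deriv ^^ Suc j) f z\<bar> \<le> \<bar>b - a\<bar> * K'" by (rule mult_left_mono) simp
    then show ?thesis unfolding z(3) abs_mult by (simp only: mult.commute)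
  qed
  have "\<bar>(deriv ^^ j) f b - (deriv ^^ j) f a\<bar> \<le> K' * \<bar>b - a\<bar>"
    if "f \<in> G" "a \<in> {c..d}" "b \<in> {c..d}" for f a b
    using less[of f a b] less[of f b a] that
    by (cases a b rule: linorder_cases) (auto simp: abs_minus_commute)
  then show ?case by blast
qed

section \<open>Differentiation under the integral sign\<close>

text \<open>
  The difference quotients are dominated by \<open>K * \<bar>u\<bar>\<close>. Measurability of the derivative in the parameter
  is a consequence, since it is a limit of difference quotients.
\<close>

lemma has_derivative_integral_param:
  fixes g :: "'a \<Rightarrow> real \<Rightarrow> real"
  assumes u: "integrable M u" and \<delta>: "\<delta> > 0"
    and g: "\<And>z. z \<in> ball y \<delta> \<Longrightarrow> integrable M (\<lambda>x. g x z * u x)"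
    and der: "\<And>x. (g x has_field_derivative g' x) (at y)"
    and Lip: "\<And>x z. z \<in> ball y \<delta> \<Longrightarrow> \<bar>g x z - g x y\<bar> \<le> K * \<bar>z - y\<bar>"
  shows "integrable M (\<lambda>x. g' x * u x)"
    and "((\<lambda>z. LINT x|M. g x z * u x) has_field_derivative (LINT x|M. g' x * u x)) (at y)"
proof -
  define s where "s X i x = (g x (X i) - g x y) / (X i - y) * u x" for X :: "nat \<Rightarrow> real" and i x
  have main: "integrable M (\<lambda>x. g' x * u x)" "(\<lambda>i. LINT x|M. s X i x) \<longlonglongrightarrow> (LINT x|M. g' x * u x)"
    if X: "\<And>i. X i \<in> ball y \<delta> - {y}" "X \<longlonglongrightarrow> y" for X
  proof -
    have y: "y \<in> ball y \<delta>" using \<delta> by simp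
    have s_int: "integrable M (s X i)" for i
    proof -
      have "integrable M (\<lambda>x. (g x (X i) * u x - g x y * u x) / (X i - y))"
        using g[of "X i"] g[OF y] X(1)[of i] by simp
      then show ?thesis unfolding s_def by (simp add: field_simps)
    qed
    have lim: "(\<lambda>i. s X i x) \<longlonglongrightarrow> g' x * u x" for x
    proof -
      have "((\<lambda>z. (g x z - g x y) / (z - y)) \<longlongrightarrow> g' x) (at y)"
        using der[of x] by (simp add: has_field_derivative_iff)
      moreover have "filterlim X (at y) sequentially"
        using X by (intro filterlim_atI) (auto intro!: always_eventually)
      ultimately have "(\<lambda>i. (g x (X i) - g x y) / (X i - y)) \<longlonglongrightarrow> g' x"
        by (rule filterlim_compose)
      then show ?thesis unfolding s_def by (intro tendsto_intros)
    qed
    have meas: "(\<lambda>x. g' x * u x) \<in> borel_measurable M"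
      using lim borel_measurable_integrable[OF s_int] by (rule borel_measurable_LIMSEQ_real)
    have bound: "norm (s X i x) \<le> K * \<bar>u x\<bar>" for i x
    proof -
      have "\<bar>g x (X i) - g x y\<bar> / \<bar>X i - y\<bar> \<le> K"
        using Lip[of "X i" x] X(1)[of i] by (simp add: divide_le_eq)
      then have "\<bar>g x (X i) - g x y\<bar> / \<bar>X i - y\<bar> * \<bar>u x\<bar> \<le> K * \<bar>u x\<bar>"
        by (rule mult_right_mono) simp
      then show ?thesis by (simp add: s_def abs_mult abs_divide)
    qed
    have w: "integrable M (\<lambda>x. K * \<bar>u x\<bar>)" using u by simp
    show "integrable M (\<lambda>x. g' x * u x)"
      by (rule integrable_dominated_convergence[where s = "s X", OF meas borel_measurable_integrable[OF s_int] w])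
        (use lim bound in auto)
    show "(\<lambda>i. LINT x|M. s X i x) \<longlonglongrightarrow> (LINT x|M. g' x * u x)"
      by (rule integral_dominated_convergence[where s = "s X", OF meas borel_measurable_integrable[OF s_int] w])
        (use lim bound in auto)
  qed
  \<comment> \<open>Any sequence with limit \<open>y\<close> that avoids \<open>y\<close> will do for integrability.\<close>
  define X where "X i = y + \<delta> / 2 * inverse (real (Suc i))" for i
  have "X \<longlonglongrightarrow> y + \<delta> / 2 * 0"
    unfolding X_def by (intro tendsto_intros LIMSEQ_inverse_real_of_nat)
  moreover have "X i \<in> ball y \<delta> - {y}" for i
  proof -
    have "inverse (real (Suc i)) \<le> 1" "0 < inverse (real (Suc i))" by (auto simp: field_simps)
    then have "0 < \<delta> / 2 * inverse (real (Suc i))" "\<delta> / 2 * inverse (real (Suc i)) \<le> \<delta> / 2 * 1"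
      using \<delta> by (auto intro!: mult_pos_pos mult_left_mono simp del: of_nat_Suc)
    then show ?thesis using \<delta> by (simp add: X_def dist_real_def del: of_nat_Suc)
  qed
  ultimately show "integrable M (\<lambda>x. g' x * u x)" using main(1)[of X] by simp
  have "((\<lambda>z. ((LINT x|M. g x z * u x) - (LINT x|M. g x y * u x)) / (z - y)) \<longlongrightarrow>
      (LINT x|M. g' x * u x)) (at y within ball y \<delta>)"
    unfolding tendsto_at_iff_sequentially
  proof (intro allI impI)
    fix X :: "nat \<Rightarrow> real" assume X: "\<forall>i. X i \<in> ball y \<delta> - {y}" "X \<longlonglongrightarrow> y"
    have y: "y \<in> ball y \<delta>" using \<delta> by simp
    have "(LINT x|M. s X i x) = ((LINT x|M. g x (X i) * u x) - (LINT x|M. g x y * u x)) / (X i - y)" for i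
    proof -
      have "(LINT x|M. s X i x) = (LINT x|M. (g x (X i) * u x - g x y * u x) / (X i - y))"
        unfolding s_def by (simp add: algebra_simps)
      then show ?thesis using g[of "X i"] g[OF y] X(1) by simp
    qed
    then show "((\<lambda>z. ((LINT x|M. g x z * u x) - (LINT x|M. g x y * u x)) / (z - y)) \<circ> X)
        \<longlonglongrightarrow> (LINT x|M. g' x * u x)"
      using main(2)[of X] X by (simp add: comp_def)
  qed
  then show "((\<lambda>z. LINT x|M. g x z * u x) has_field_derivative (LINT x|M. g' x * u x)) (at y)"
    using at_within_open[of y "ball y \<delta>"] \<delta> by (simp add: has_field_derivative_iff)
qed

lemma smooth_integral_param:
  fixes g :: "'a \<Rightarrow> real \<Rightarrow> real"
  assumes u: "integrable M u"
    and g: "\<And>y. -1 < y \<Longrightarrow> y < 1 \<Longrightarrow> integrable M (\<lambda>x. g x y * u x)"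
    and smooth: "\<And>x. smooth_below n (g x)"
    and B: "\<And>x y. -1 < y \<Longrightarrow> y < 1 \<Longrightarrow> \<bar>g x y\<bar> \<le> B"
    and L: "\<And>x. weighted_Lipschitz r C ((deriv ^^ n) (g x))" and C: "C \<ge> 0"
  defines "F \<equiv> \<lambda>y. LINT x|M. g x y * u x"
  shows "smooth_below n F"
    and "weighted_Lipschitz r (C * (LINT x|M. \<bar>u x\<bar>)) ((deriv ^^ n) F)"
proof -
  define H where "H j y = (LINT x|M. (deriv ^^ j) (g x) y * u x)" for j y
  have step: "integrable M (\<lambda>x. (deriv ^^ Suc j) (g x) y * u x)"
    "(H j has_field_derivative H (Suc j) y) (at y)"
    if j: "j < n" and int: "\<And>y. -1 < y \<Longrightarrow> y < 1 \<Longrightarrow> integrable M (\<lambda>x. (deriv ^^ j) (g x) y * u x)"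
      and y: "-1 < y" "y < 1" for j y
  proof -
    define \<delta> where "\<delta> = min (1 - y) (1 + y) / 2"
    have \<delta>: "\<delta> > 0" "-1 < y - \<delta>" "y - \<delta> < y + \<delta>" "y + \<delta> < 1"
      using y by (auto simp: \<delta>_def min_def field_simps)
    obtain K where K: "\<forall>f\<in>range g. \<forall>a\<in>{y - \<delta>..y + \<delta>}. \<forall>b\<in>{y - \<delta>..y + \<delta>}.
        \<bar>(deriv ^^ j) f b - (deriv ^^ j) f a\<bar> \<le> K * \<bar>b - a\<bar>"
    proof -
      have "\<exists>K. \<forall>f\<in>range g. \<forall>a\<in>{y - \<delta>..y + \<delta>}. \<forall>b\<in>{y - \<delta>..y + \<delta>}.
          \<bar>(deriv ^^ j) f b - (deriv ^^ j) f a\<bar> \<le> K * \<bar>b - a\<bar>"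
      proof (rule uniform_Lipschitz_derivatives[of "range g" n B r C])
        show "smooth_below n f" if "f \<in> range g" for f using that smooth by auto
        show "\<bar>f z\<bar> \<le> B" if "f \<in> range g" "-1 < z" "z < 1" for f z using that B by auto
        show "weighted_Lipschitz r C ((deriv ^^ n) f)" if "f \<in> range g" for f using that L by auto
      qed (use C \<delta> j in auto)
      then show thesis using that by blast
    qed
    have Lip: "\<bar>(deriv ^^ j) (g x) z - (deriv ^^ j) (g x) y\<bar> \<le> K * \<bar>z - y\<bar>" if "z \<in> ball y \<delta>" for x z
    proof -
      have "y \<in> {y - \<delta>..y + \<delta>}" "z \<in> {y - \<delta>..y + \<delta>}"
        using that \<delta>(1) by (auto simp: dist_real_def)
      then show ?thesis using K by blast
    qed
    have int': "integrable M (\<lambda>x. (deriv ^^ j) (g x) z * u x)" if "z \<in> ball y \<delta>" for z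
      using that \<delta> by (intro int) (auto simp: dist_real_def)
    note deriv = has_derivative_integral_param[OF u \<delta>(1) int' smooth_belowD[OF smooth j y] Lip]
    show "integrable M (\<lambda>x. (deriv ^^ Suc j) (g x) y * u x)" by (rule deriv(1))
    show "(H j has_field_derivative H (Suc j) y) (at y)" unfolding H_def by (rule deriv(2))
  qed
  have int: "integrable M (\<lambda>x. (deriv ^^ j) (g x) y * u x)" if "j \<le> n" "-1 < y" "y < 1" for j y
    using that
  proof (induction j arbitrary: y)
    case 0
    then show ?case using g by simp
  next
    case (Suc j)
    then show ?case using step(1)[of j y] by simp
  qed
  have H_deriv: "(H j has_field_derivative H (Suc j) y) (at y)" if "j < n" "-1 < y" "y < 1" for j y
    using step(2)[of j y] int[of j] that by simp
  have F_deriv: "((deriv ^^ j) F has_field_derivative H (Suc j) y) (at y)"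
    if "\<And>y. -1 < y \<Longrightarrow> y < 1 \<Longrightarrow> (deriv ^^ j) F y = H j y" "j < n" "-1 < y" "y < 1" for j y
    using that by (intro has_field_derivative_transform_within_open[OF H_deriv, of j y "{-1<..<1}"]) auto
  have eq: "(deriv ^^ j) F y = H j y" if "j \<le> n" "-1 < y" "y < 1" for j y
    using that
  proof (induction j arbitrary: y)
    case 0
    then show ?case by (simp add: F_def H_def)
  next
    case (Suc j)
    then have "((deriv ^^ j) F has_field_derivative H (Suc j) y) (at y)"
      by (intro F_deriv) auto
    then show ?case by (simp add: DERIV_imp_deriv)
  qed
  show "smooth_below n F"
    unfolding smooth_below_def
  proof (intro allI impI ballI)
    fix j y assume "j < n" "y \<in> {-1<..<1::real}"
    then have "((deriv ^^ j) F has_field_derivative H (Suc j) y) (at y)"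
      by (intro F_deriv eq) auto
    then show "(deriv ^^ j) F differentiable (at y)" by (auto simp: real_differentiable_def)
  qed
  show "weighted_Lipschitz r (C * (LINT x|M. \<bar>u x\<bar>)) ((deriv ^^ n) F)"
    unfolding weighted_Lipschitz_def
  proof (intro allI impI)
    fix a b :: real assume ab: "-1 < a" "a \<le> b" "b < 1"
    let ?W = "max (boundary_weight r a) (boundary_weight r b)"
    have ia: "integrable M (\<lambda>x. (deriv ^^ n) (g x) a * u x)"
      and ib: "integrable M (\<lambda>x. (deriv ^^ n) (g x) b * u x)"
      using ab by (auto intro!: int)
    have "\<bar>(deriv ^^ n) F b - (deriv ^^ n) F a\<bar> =
        norm (LINT x|M. ((deriv ^^ n) (g x) b - (deriv ^^ n) (g x) a) * u x)"
      using ab ia ib by (simp add: eq H_def left_diff_distrib)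
    also have "\<dots> \<le> (LINT x|M. norm (((deriv ^^ n) (g x) b - (deriv ^^ n) (g x) a) * u x))"
      by (rule integral_norm_bound)
    also have "\<dots> \<le> (LINT x|M. C * ?W * (b - a) * \<bar>u x\<bar>)"
    proof (rule integral_mono)
      show "integrable M (\<lambda>x. norm (((deriv ^^ n) (g x) b - (deriv ^^ n) (g x) a) * u x))"
        using ia ib by (intro integrable_norm) (simp add: left_diff_distrib)
      show "integrable M (\<lambda>x. C * ?W * (b - a) * \<bar>u x\<bar>)" using u by simp
      fix x
      have "\<bar>(deriv ^^ n) (g x) b - (deriv ^^ n) (g x) a\<bar> \<le> C * ?W * (b - a)"
        using L[of x] ab unfolding weighted_Lipschitz_def by blast
      then show "norm (((deriv ^^ n) (g x) b - (deriv ^^ n) (g x) a) * u x) \<le> C * ?W * (b - a) * \<bar>u x\<bar>"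
        unfolding real_norm_def abs_mult by (rule mult_right_mono) simp
    qed
    also have "\<dots> = C * (LINT x|M. \<bar>u x\<bar>) * ?W * (b - a)" by simp
    finally show "\<bar>(deriv ^^ n) F b - (deriv ^^ n) F a\<bar> \<le> C * (LINT x|M. \<bar>u x\<bar>) * ?W * (b - a)" .
  qed
qed

section \<open>Regularity of the integral operators and of fixed points\<close>

lemma int_op_in_W_space:
  assumes r: "r \<ge> 1" and k: "kernel_cond k" and sections: "kernel_sections_bounded r k"
    and u: "continuous_on UNIV u"
  shows "int_op k u \<in> W_space r"
proof -
  define f where "f x = Bcontfun (k x)" for x
  have f: "apply_bcontfun (f x) = k x" "f x \<in> W_space r" for x
    using sections by (auto simp: f_def kernel_sections_bounded_def Bcontfun_inverse)
  obtain C where C: "C \<ge> 0" "\<And>x. norm (f x) \<le> C" "\<And>x. weighted_seminorm r (f x) \<le> ereal C"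
  proof -
    define S where "S = (SUP x. W_norm r (f x))"
    have S: "W_norm r (f x) \<le> S" for x unfolding S_def by (rule SUP_upper) simp
    have nonneg: "0 \<le> W_norm r (f x)" for x
      unfolding W_norm_def by (intro add_nonneg_nonneg weighted_seminorm_nonneg) simp
    have "S < \<infinity>" using sections by (simp add: S_def f_def kernel_sections_bounded_def)
    moreover have "0 \<le> S" using nonneg S order_trans by blast
    ultimately obtain C where C: "S = ereal C" "C \<ge> 0" by (cases S) auto
    show thesis
    proof (rule that[OF C(2)])
      fix x
      have "ereal (norm (f x)) \<le> W_norm r (f x)"
        unfolding W_norm_def using weighted_seminorm_nonneg[of r "f x"] by (simp add: add_increasing2)
      then show "norm (f x) \<le> C" using S[of x] C(1) by (metis ereal_less_eq(3) order_trans)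
      have "weighted_seminorm r (f x) \<le> W_norm r (f x)"
        unfolding W_norm_def using weighted_seminorm_nonneg[of r "f x"] by (simp add: add_increasing)
      then show "weighted_seminorm r (f x) \<le> ereal C" using S[of x] C(1) by simp
    qed
  qed
  define g where "g x y = k (to_icc x) (to_icc y)" for x y
  have gf: "g x = (\<lambda>y. f (to_icc x) (to_icc y))" for x by (rule ext) (simp add: g_def f)
  let ?M = "lebesgue_on {-1..1::real}"
  have "continuous_on {-1..1} (\<lambda>x. u (to_icc x))"
    using continuous_on_compose2[OF u continuous_on_to_icc] by simp
  then have ui: "integrable ?M (\<lambda>x. u (to_icc x))" by (intro continuous_imp_integrable_real)
  note smooth = smooth_integral_param[where g = g and n = "r - 1" and r = r and C = C and B = C, OF ui]
  have F: "(\<lambda>y. int_op k u (to_icc y)) = (\<lambda>y. LINT x|?M. g x y * u (to_icc x))"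
    by (simp add: apply_int_op[OF k u] g_def)
  have 1: "integrable ?M (\<lambda>x. g x y * u (to_icc x))" for y
    unfolding g_def by (rule integrable_kernel_mult[OF k u])
  have 2: "smooth_below (r - 1) (g x)" for x
    unfolding gf by (rule W_spaceD(1)[OF r f(2)])
  have 3: "\<bar>g x y\<bar> \<le> C" for x y
    using abs_apply_le_norm[of "f (to_icc x)" "to_icc y"] C(2)[of "to_icc x"] by (simp add: gf)
  have 4: "weighted_Lipschitz r C ((deriv ^^ (r - 1)) (g x))" for x
    using W_spaceD(2)[OF r f(2) C(3,1)] unfolding gf nth_deriv_def .
  show ?thesis
  proof (rule W_spaceI[OF r])
    show "smooth_below (r - 1) (\<lambda>y. int_op k u (to_icc y))"
      unfolding F by (rule smooth(1)[OF 1 2 3 4 C(1)])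
    show "weighted_Lipschitz r (C * (LINT x|?M. \<bar>u (to_icc x)\<bar>)) (nth_deriv (r - 1) (int_op k u))"
      unfolding nth_deriv_def F by (rule smooth(2)[OF 1 2 3 4 C(1)])
    show "0 \<le> C * (LINT x|?M. \<bar>u (to_icc x)\<bar>)" using C(1) by simp
  qed
qed

text \<open>
  Lipschitz constants add. For derivatives, additivity holds only inside the open interval, as nothing
  is known about the functions elsewhere; hence the localised induction.
\<close>

lemma W_space_add:
  assumes r: "r \<ge> 1" and f: "f \<in> W_space r" and g: "g \<in> W_space r"
  shows "f + g \<in> W_space r"
proof -
  have Lip: "\<exists>C\<ge>0. weighted_Lipschitz r C (nth_deriv (r - 1) f)" if "f \<in> W_space r" for f
  proof -
    have "weighted_seminorm r f < \<infinity>" using that by (simp add: W_space_def)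
    then obtain C where "weighted_seminorm r f = ereal C" "C \<ge> 0"
      using weighted_seminorm_nonneg[of r f] by (cases "weighted_seminorm r f") auto
    then show ?thesis using W_spaceD(2)[OF r that, of C] by auto
  qed
  obtain A B where A: "A \<ge> 0" "weighted_Lipschitz r A (nth_deriv (r - 1) f)"
    and B: "B \<ge> 0" "weighted_Lipschitz r B (nth_deriv (r - 1) g)"
    using Lip[OF f] Lip[OF g] by blast
  define \<phi> \<psi> where "\<phi> = (\<lambda>y. f (to_icc y))" and "\<psi> = (\<lambda>y. g (to_icc y))"
  let ?s = "\<lambda>y. \<phi> y + \<psi> y"
  have sm: "smooth_below (r - 1) \<phi>" "smooth_below (r - 1) \<psi>"
    unfolding \<phi>_def \<psi>_def by (rule W_spaceD(1)[OF r f] W_spaceD(1)[OF r g])+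
  have der: "((deriv ^^ j) ?s has_field_derivative (deriv ^^ Suc j) \<phi> y + (deriv ^^ Suc j) \<psi> y) (at y)"
    if "\<And>y. -1 < y \<Longrightarrow> y < 1 \<Longrightarrow> (deriv ^^ j) ?s y = (deriv ^^ j) \<phi> y + (deriv ^^ j) \<psi> y"
      "j < r - 1" "-1 < y" "y < 1" for j y
    using that
    by (intro has_field_derivative_transform_within_open[OF
          DERIV_add[OF smooth_belowD[OF sm(1)] smooth_belowD[OF sm(2)]], of j y j "{-1<..<1}"]) auto
  have eq: "(deriv ^^ j) ?s y = (deriv ^^ j) \<phi> y + (deriv ^^ j) \<psi> y"
    if "j \<le> r - 1" "-1 < y" "y < 1" for j y
    using that
  proof (induction j arbitrary: y)
    case (Suc j)
    then have "((deriv ^^ j) ?s has_field_derivative (deriv ^^ Suc j) \<phi> y + (deriv ^^ Suc j) \<psi> y) (at y)"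
      by (intro der) auto
    then show ?case by (simp add: DERIV_imp_deriv)
  qed simp
  have s: "(\<lambda>y. (f + g) (to_icc y)) = ?s" by (simp add: \<phi>_def \<psi>_def)
  show ?thesis
  proof (rule W_spaceI[OF r])
    show "smooth_below (r - 1) (\<lambda>y. (f + g) (to_icc y))"
      unfolding s smooth_below_def
    proof (intro allI impI ballI)
      fix j y assume "j < r - 1" "y \<in> {-1<..<1::real}"
      then have "((deriv ^^ j) ?s has_field_derivative (deriv ^^ Suc j) \<phi> y + (deriv ^^ Suc j) \<psi> y) (at y)"
        by (intro der eq) auto
      then show "(deriv ^^ j) ?s differentiable (at y)" by (auto simp: real_differentiable_def)
    qed
    show "weighted_Lipschitz r (A + B) (nth_deriv (r - 1) (f + g))"
      unfolding weighted_Lipschitz_def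
    proof (intro allI impI)
      fix a b :: real assume ab: "-1 < a" "a \<le> b" "b < 1"
      let ?W = "max (boundary_weight r a) (boundary_weight r b)"
      have eq': "nth_deriv (r - 1) (f + g) y = nth_deriv (r - 1) f y + nth_deriv (r - 1) g y"
        if "-1 < y" "y < 1" for y
        using eq[of "r - 1" y] that unfolding nth_deriv_def s by (simp add: \<phi>_def \<psi>_def)
      have "\<bar>nth_deriv (r - 1) f b - nth_deriv (r - 1) f a\<bar> \<le> A * ?W * (b - a)"
        "\<bar>nth_deriv (r - 1) g b - nth_deriv (r - 1) g a\<bar> \<le> B * ?W * (b - a)"
        using A B ab unfolding weighted_Lipschitz_def by blast+
      moreover have "(A + B) * ?W * (b - a) = A * ?W * (b - a) + B * ?W * (b - a)"
        by (simp add: algebra_simps)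
      ultimately show "\<bar>nth_deriv (r - 1) (f + g) b - nth_deriv (r - 1) (f + g) a\<bar> \<le> (A + B) * ?W * (b - a)"
        using eq'[of a] eq'[of b] ab by linarith
    qed
  qed (use A B in auto)
qed

theorem theorem3p2:
  fixes k\<^sub>1 k\<^sub>2 :: "icc \<Rightarrow> icc \<Rightarrow> real" and h :: "icc \<Rightarrow> real \<Rightarrow> real"
    and g fstar :: C0 and r :: nat
  assumes r: "r \<ge> 1"
    and K1: "kernel_cond k\<^sub>1" "kernel_cond k\<^sub>2"
    and H1: "continuous_on UNIV (\<lambda>(x, v). h x v)"
    and H2: "\<And>x v. h x differentiable (at v)"
      "continuous_on UNIV (\<lambda>(x, v). deriv (h x) v)"
    and G: "completely_continuous (G_op k\<^sub>1 k\<^sub>2 h g)"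
    and fixed_point: "G_op k\<^sub>1 k\<^sub>2 h g fstar = fstar"
    and invertible: "\<exists>S. bounded_linear S \<and>
      (\<forall>\<phi>. S (\<phi> - G_deriv k\<^sub>1 k\<^sub>2 h fstar \<phi>) = \<phi>) \<and>
      (\<forall>\<psi>. S \<psi> - G_deriv k\<^sub>1 k\<^sub>2 h fstar (S \<psi>) = \<psi>)"
    and not_eigenvalue: "\<not> (\<exists>\<phi>. \<phi> \<noteq> 0 \<and> G_deriv k\<^sub>1 k\<^sub>2 h fstar \<phi> = \<phi>)"
    and sections: "kernel_sections_bounded r k\<^sub>1" "kernel_sections_bounded r k\<^sub>2"
  shows "(\<forall>f. K_op k\<^sub>1 k\<^sub>2 h f \<in> W_space r) \<and> (g \<in> W_space r \<longrightarrow> fstar \<in> W_space r)"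
proof -
  have K: "K_op k\<^sub>1 k\<^sub>2 h f \<in> W_space r" for f
  proof -
    have "int_op k\<^sub>1 f \<in> W_space r"
      by (rule int_op_in_W_space[OF r K1(1) sections(1) continuous_on_apply_bcontfun])
    moreover have "int_op k\<^sub>2 (superposition h f) \<in> W_space r"
      using continuous_on_superposition[OF H1, of f]
      by (intro int_op_in_W_space[OF r K1(2) sections(2)]) (simp add: superposition_def)
    ultimately show ?thesis unfolding K_op_def by (rule W_space_add[OF r])
  qed
  moreover have "fstar \<in> W_space r" if "g \<in> W_space r"
    using W_space_add[OF r K[of fstar] that] fixed_point by (simp add: G_op_def)
  ultimately show ?thesis by blast
qed

end
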